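(* There exist a randomized online paging algorithm and an absolute constant $c>0$ such that, for every paging instance (pages $[n]$, cache size $k<n$, request sequence $\sigma\in[n]^T$) and every collection of $M$ NAT predictors, when the algorithm has bandit access to the $M$ predictors its expected cost satisfies $$\mathbb{E}[\operatorname{cost}(\mathtt{Alg})]-\mathtt{OPT}\le c\left(\eta^{\min}+T^{2/3}kM^{1/2}\right),$$ where $\eta^{\min}=\min_{j\in[M]}\eta^j$ and $\eta^j=|\{t\in[T]:p^j_t\neq A_t(\sigma_t)\}|$.
   Context: Paging: $n$ pages, cache of exactly $k<n$ pages, request sequence $\sigma=(\sigma_t)_{t\in[T]}\in[n]^T$ revealed online; a cache miss at round $t$ occurs when $\sigma_t$ is not in the cache, and then some cached page must be evicted to bring in $\sigma_t$; the cost is the number of cache misses. With virtual requests $\sigma_{T+i}=i$ ($i\in[n]$), the next arrival time is $A_t(i)=\min\{t'>t:\sigma_{t'}=i\}$. $\mathtt{OPT}$ is the cost of the optimal offline algorithm (furthest in the future). A NAT predictor $j\in[M]$ produces in each round $t$ a prediction $p^j_t\in(t,T+n]$ for $A_t(\sigma_t)$. Bandit access: in each round $t$ the algorithm selects a single predictor $j\in[M]$ and receives only $p^j_t$; if the algorithm must evict in round $t$, the eviction decision is made before receiving the round-$t$ prediction. The algorithm does not know which predictor is best nor the values $\eta^j$. *)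

theory Defs
  imports "HOL-Probability.Probability_Mass_Function"
begin

text \<open>
  Pages are \<open>{1..n}\<close>, predictors are \<open>{1..M}\<close> and rounds are \<open>{1..T}\<close>. A request sequence is a list
  \<open>\<sigma>\<close> with \<open>T = length \<sigma>\<close>, so the request of round \<open>t\<close> is \<open>\<sigma> ! (t - 1)\<close>. The cache always holds
  exactly \<open>k\<close> pages; the initial cache content is arbitrary and common to all algorithms.
\<close>

section \<open>Paging\<close>

text \<open>\<open>None\<close> stands for ``no eviction'', which is the only option on a cache hit.\<close>

definition legal_eviction :: "nat set \<Rightarrow> nat \<Rightarrow> nat option \<Rightarrow> bool" where
  "legal_eviction C r e \<longleftrightarrow> (if r \<in> C then e = None else (\<exists>x\<in>C. e = Some x))"

definition cache_step :: "nat set \<Rightarrow> nat \<Rightarrow> nat option \<Rightarrow> nat set" where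
  "cache_step C r e = (case e of None \<Rightarrow> C | Some x \<Rightarrow> insert r (C - {x}))"

type_synonym run = "(nat \<times> nat option) list"

fun cache_after :: "nat set \<Rightarrow> run \<Rightarrow> nat set" where
  "cache_after C [] = C"
| "cache_after C ((r, e) # xs) = cache_after (cache_step C r e) xs"

fun legal_run :: "nat set \<Rightarrow> run \<Rightarrow> bool" where
  "legal_run C [] \<longleftrightarrow> True"
| "legal_run C ((r, e) # xs) \<longleftrightarrow> legal_eviction C r e \<and> legal_run (cache_step C r e) xs"

fun num_misses :: "nat set \<Rightarrow> run \<Rightarrow> nat" where
  "num_misses C [] = 0"
| "num_misses C ((r, e) # xs) = (if r \<in> C then 0 else 1) + num_misses (cache_step C r e) xs"

definition OPT :: "nat set \<Rightarrow> nat list \<Rightarrow> nat" where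
  "OPT C0 \<sigma> = Inf {num_misses C0 xs | xs. map fst xs = \<sigma> \<and> legal_run C0 xs}"


section \<open>Next arrival time predictors\<close>

text \<open>Includes the virtual requests \<open>T + i \<mapsto> i\<close>.\<close>

definition request_at :: "nat list \<Rightarrow> nat \<Rightarrow> nat" where
  "request_at \<sigma> t = (if t \<le> length \<sigma> then \<sigma> ! (t - 1) else t - length \<sigma>)"

definition next_arrival :: "nat list \<Rightarrow> nat \<Rightarrow> nat \<Rightarrow> nat" where
  "next_arrival \<sigma> t i = (LEAST t'. t < t' \<and> request_at \<sigma> t' = i)"

text \<open>\<open>p j t\<close> is the prediction of predictor \<open>j\<close> in round \<open>t\<close>.\<close>

definition NAT_predictors :: "nat \<Rightarrow> nat \<Rightarrow> nat list \<Rightarrow> (nat \<Rightarrow> nat \<Rightarrow> nat) \<Rightarrow> bool" where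
  "NAT_predictors n M \<sigma> p \<longleftrightarrow>
     (\<forall>j\<in>{1..M}. \<forall>t\<in>{1..length \<sigma>}. p j t \<in> {t<..length \<sigma> + n})"

definition num_errors :: "nat list \<Rightarrow> (nat \<Rightarrow> nat) \<Rightarrow> nat" where
  "num_errors \<sigma> q = card {t \<in> {1..length \<sigma>}. q t \<noteq> next_arrival \<sigma> t (request_at \<sigma> t)}"

definition eta_min :: "nat \<Rightarrow> nat list \<Rightarrow> (nat \<Rightarrow> nat \<Rightarrow> nat) \<Rightarrow> nat" where
  "eta_min M \<sigma> p = Min ((\<lambda>j. num_errors \<sigma> (p j)) ` {1..M})"


section \<open>Randomized online algorithms with bandit access\<close>

text \<open>What the algorithm has done and observed in one round.\<close>

datatype round_log =
  Round (request: nat) (evicted: "nat option") (queried: nat) (prediction: nat)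

definition run_of :: "round_log list \<Rightarrow> run" where
  "run_of h = map (\<lambda>x. (request x, evicted x)) h"

text \<open>
  A strategy maps the log of the previous rounds and the current request to a distribution over pairs
  of an eviction and a queried predictor. The prediction of the current round enters only the log, so
  it cannot influence the eviction of that round. An algorithm knows \<open>n\<close>, \<open>k\<close>, \<open>M\<close> and the initial
  cache, but neither the number \<open>T\<close> of rounds nor the predictions it does not query.
\<close>

type_synonym strategy = "round_log list \<Rightarrow> nat \<Rightarrow> (nat option \<times> nat) pmf"
type_synonym algorithm = "nat \<Rightarrow> nat \<Rightarrow> nat \<Rightarrow> nat set \<Rightarrow> strategy"

definition paging_params :: "nat \<Rightarrow> nat \<Rightarrow> nat set \<Rightarrow> bool" where
  "paging_params n k C0 \<longleftrightarrow> 1 \<le> k \<and> k < n \<and> C0 \<subseteq> {1..n} \<and> card C0 = k"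

definition legal_strategy :: "nat \<Rightarrow> nat \<Rightarrow> nat set \<Rightarrow> strategy \<Rightarrow> bool" where
  "legal_strategy n M C0 S \<longleftrightarrow>
     (\<forall>h r. request ` set h \<subseteq> {1..n} \<and> queried ` set h \<subseteq> {1..M} \<and> legal_run C0 (run_of h)
            \<and> r \<in> {1..n} \<longrightarrow>
        (\<forall>(e, j) \<in> set_pmf (S h r). legal_eviction (cache_after C0 (run_of h)) r e \<and> j \<in> {1..M}))"

definition online_paging_algorithm :: "algorithm \<Rightarrow> bool" where
  "online_paging_algorithm A \<longleftrightarrow>
     (\<forall>n k M C0. paging_params n k C0 \<and> 1 \<le> M \<longrightarrow> legal_strategy n M C0 (A n k M C0))"

text \<open>The log after serving the given requests, starting from log \<open>h\<close>.\<close>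

fun play :: "strategy \<Rightarrow> (nat \<Rightarrow> nat \<Rightarrow> nat) \<Rightarrow> round_log list \<Rightarrow> nat list \<Rightarrow> round_log list pmf" where
  "play S p h [] = return_pmf h"
| "play S p h (r # rs) =
     bind_pmf (S h r) (\<lambda>(e, j). play S p (h @ [Round r e j (p j (Suc (length h)))]) rs)"

definition expected_cost :: "strategy \<Rightarrow> nat set \<Rightarrow> (nat \<Rightarrow> nat \<Rightarrow> nat) \<Rightarrow> nat list \<Rightarrow> real" where
  "expected_cost S C0 p \<sigma> =
     measure_pmf.expectation (play S p [] \<sigma>) (\<lambda>h. real (num_misses C0 (run_of h)))"

end

theory Submission
  imports Defs
begin

text \<open>
  Rounds are grouped into blocks. At the start of a block the algorithm forgets all predictions and
  draws one predictor by EXP3; during the block it queries only this predictor and evicts a page whose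
  predicted arrival has passed (or which has no prediction), and otherwise the page predicted to arrive
  last. The EXP3 loss of the block is the number of its predictions that are refuted by the requests up
  to the end of the block. Unlike the true number of errors, this is known when the block ends.

  A potential argument compares the cache with that of any offline algorithm: per block the algorithm
  misses at most \<open>k\<close> times more, plus twice the loss. The loss of the best predictor is at most
  \<open>\<eta>\<^sup>m\<^sup>i\<^sup>n\<close>. With block lengths of order \<open>T\<^sup>1\<^sup>/\<^sup>3 / M\<^sup>1\<^sup>/\<^sup>2\<close> both the number of blocks and the EXP3 regret
  are of order \<open>T\<^sup>2\<^sup>/\<^sup>3 M\<^sup>1\<^sup>/\<^sup>2\<close>: making the blocks shorter as \<open>M\<close> grows absorbs the factor \<open>ln M\<close>. If
  \<open>T \<le> M\<^sup>3\<^sup>/\<^sup>2\<close>, the trivial bound \<open>T\<close> on the cost suffices.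
\<close>

section \<open>EXP3 with varying learning rates\<close>

definition gibbs :: "'a set \<Rightarrow> real \<Rightarrow> ('a \<Rightarrow> real) \<Rightarrow> 'a \<Rightarrow> real" where
  "gibbs A g L j = exp (- g * L j) / (\<Sum>i\<in>A. exp (- g * L i))"

definition gibbs_pmf :: "'a set \<Rightarrow> real \<Rightarrow> ('a \<Rightarrow> real) \<Rightarrow> 'a pmf" where
  "gibbs_pmf A g L = embed_pmf (\<lambda>j. if j \<in> A then gibbs A g L j else 0)"

text \<open>The free energy, a smooth minimum. Averaging over \<open>A\<close> instead of summing
  makes it 0 at \<open>L = 0\<close> and antitone in \<open>g\<close>, as decreasing learning rates
  require.\<close>

definition soft_min :: "'a set \<Rightarrow> real \<Rightarrow> ('a \<Rightarrow> real) \<Rightarrow> real" where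
  "soft_min A g L = - ln ((\<Sum>i\<in>A. exp (- g * L i)) / real (card A)) / g"

text \<open>Importance-weighted cumulative losses. Only \<open>l i (J i)\<close>, the loss of the
  drawn action, is read, so bandit feedback suffices to compute them.\<close>

fun estimate :: "'a set \<Rightarrow> (nat \<Rightarrow> real) \<Rightarrow> (nat \<Rightarrow> 'a \<Rightarrow> real) \<Rightarrow> (nat \<Rightarrow> 'a) \<Rightarrow> nat \<Rightarrow> 'a \<Rightarrow> real" where
  "estimate A g l J 0 = (\<lambda>_. 0)"
| "estimate A g l J (Suc i) =
     (let L = estimate A g l J i in L(J i := L (J i) + l i (J i) / gibbs A (g i) L (J i)))"

fun exp3 :: "'a set \<Rightarrow> (nat \<Rightarrow> real) \<Rightarrow> (nat \<Rightarrow> 'a \<Rightarrow> real) \<Rightarrow> nat \<Rightarrow> 'a list pmf" where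
  "exp3 A g l 0 = return_pmf []"
| "exp3 A g l (Suc i) =
     bind_pmf (exp3 A g l i)
       (\<lambda>js. map_pmf (\<lambda>j. js @ [j]) (gibbs_pmf A (g i) (estimate A g l (nth js) i)))"

text \<open>Agreement along the drawn actions suffices. The coupling uses this to exchange losses
  read off the log for the true ones.\<close>

lemma estimate_cong:
  assumes "\<And>i'. i' < i \<Longrightarrow> J i' = J' i'" "\<And>i'. i' < i \<Longrightarrow> l i' (J i') = l' i' (J i')"
  shows "estimate A g l J i = estimate A g l' J' i"
  using assms by (induction i) (auto simp: Let_def)

lemma estimate_snoc:
  assumes "length js = N"
  shows "estimate A g l (nth (js @ [j])) (Suc N) =
    (let L = estimate A g l (nth js) N in L(j := L j + l N j / gibbs A (g N) L j))"
proof -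
  have "estimate A g l (nth (js @ [j])) N = estimate A g l (nth js) N"
    using assms by (intro estimate_cong) (auto simp: nth_append)
  then show ?thesis using assms by (simp add: nth_append)
qed

context
  fixes A :: "'a set"
  assumes fin: "finite A" and ne: "A \<noteq> {}"
begin

lemma partition_pos: "(\<Sum>i\<in>A. exp (- g * L i)) > (0::real)"
  by (intro sum_pos fin ne) auto

lemma gibbs_pos: "gibbs A g L j > 0"
  unfolding gibbs_def by (intro divide_pos_pos partition_pos) auto

lemma sum_gibbs: "(\<Sum>j\<in>A. gibbs A g L j) = 1"
  unfolding gibbs_def sum_divide_distrib[symmetric] using partition_pos[of g L] by simp

lemma pmf_gibbs_pmf: "pmf (gibbs_pmf A g L) j = (if j \<in> A then gibbs A g L j else 0)"
  unfolding gibbs_pmf_def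
proof (rule pmf_embed_pmf)
  show "0 \<le> (if x \<in> A then gibbs A g L x else 0)" for x
    using gibbs_pos[of g L x] by auto
  have "(\<integral>\<^sup>+ x. ennreal (if x \<in> A then gibbs A g L x else 0) \<partial>count_space UNIV)
      = (\<Sum>x\<in>A. ennreal (gibbs A g L x))"
    by (subst nn_integral_count_space'[of A]) (auto simp: fin)
  also have "\<dots> = ennreal (\<Sum>x\<in>A. gibbs A g L x)"
    by (rule sum_ennreal) (use gibbs_pos less_imp_le in blast)
  finally show "(\<integral>\<^sup>+ x. ennreal (if x \<in> A then gibbs A g L x else 0) \<partial>count_space UNIV) = 1"
    by (simp add: sum_gibbs)
qed

lemma set_gibbs_pmf: "set_pmf (gibbs_pmf A g L) = A"
  using gibbs_pos[of g L] by (auto simp: set_pmf_eq pmf_gibbs_pmf less_imp_neq[symmetric] split: if_splits)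

lemma expectation_gibbs_pmf:
  "measure_pmf.expectation (gibbs_pmf A g L) f = (\<Sum>j\<in>A. gibbs A g L j * f j)"
  by (subst integral_measure_pmf_real[OF fin]) (auto simp: set_gibbs_pmf pmf_gibbs_pmf mult.commute)

lemma soft_min_le:
  assumes "j \<in> A" "g > 0"
  shows "soft_min A g L \<le> L j + ln (real (card A)) / g"
proof -
  have "exp (- g * L j) \<le> (\<Sum>i\<in>A. exp (- g * L i))"
    using member_le_sum[OF \<open>j \<in> A\<close>, of "\<lambda>i. exp (- g * L i)"] fin by simp
  then have "- g * L j \<le> ln (\<Sum>i\<in>A. exp (- g * L i))"
    using partition_pos[of g L] by (simp add: ln_ge_iff)
  moreover have "card A > 0" using fin ne by (simp add: card_gt_0_iff)
  ultimately have "- ln ((\<Sum>i\<in>A. exp (- g * L i)) / real (card A)) \<le> g * L j + ln (real (card A))"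
    using partition_pos[of g L] by (simp add: ln_div)
  then show ?thesis unfolding soft_min_def using \<open>g > 0\<close> by (simp add: field_simps)
qed

text \<open>Power mean inequality: with \<open>s = g' / g \<le> 1\<close>, the mean of the powers
  \<open>y powr s\<close> is at most the \<open>s\<close>-th power of the mean.\<close>

lemma soft_min_antimono:
  assumes "0 < g'" "g' \<le> g"
  shows "soft_min A g L \<le> soft_min A g' L"
proof -
  define n where "n = real (card A)"
  have n: "n > 0" unfolding n_def using fin ne by (simp add: card_gt_0_iff)
  define Z where "Z = (\<Sum>i\<in>A. exp (- g * L i)) / n"
  define Z' where "Z' = (\<Sum>i\<in>A. exp (- g' * L i)) / n"
  have Z: "Z > 0" "Z' > 0" unfolding Z_def Z'_def using partition_pos n by auto
  define s where "s = g' / g"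
  have s: "0 < s" "s \<le> 1" using assms by (auto simp: s_def)
  have young: "y powr s \<le> 1 + s * (y - 1)" if "y > 0" for y :: real
    using Youngs_inequality_0[of s "1 - s" y 1] s that by (simp add: algebra_simps)
  \<comment> \<open>The tangent bound \<open>young\<close> is applied to the weights divided by
    their mean \<open>Z\<close>, so that the linear terms cancel in the sum.\<close>
  have "exp (- g' * L i) \<le> Z powr s * (1 + s * (exp (- g * L i) / Z - 1))" for i
  proof -
    have "exp (- g' * L i) = exp (- g * L i) powr s"
      using assms by (simp add: powr_def s_def)
    also have "\<dots> = Z powr s * (exp (- g * L i) / Z) powr s"
      using Z by (simp add: powr_divide)
    also have "\<dots> \<le> Z powr s * (1 + s * (exp (- g * L i) / Z - 1))"
      by (intro mult_left_mono young) (use Z in auto)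
    finally show ?thesis .
  qed
  then have "(\<Sum>i\<in>A. exp (- g' * L i)) \<le> (\<Sum>i\<in>A. Z powr s * (1 + s * (exp (- g * L i) / Z - 1)))"
    by (intro sum_mono)
  also have "\<dots> = Z powr s * (n + s * ((\<Sum>i\<in>A. exp (- g * L i)) / Z - n))"
    by (simp add: sum_distrib_left[symmetric] sum.distrib sum_subtractf sum_divide_distrib n_def)
  also have "(\<Sum>i\<in>A. exp (- g * L i)) / Z = n"
    using n Z partition_pos[of g L] unfolding Z_def by simp
  finally have "Z' \<le> Z powr s" using n unfolding Z'_def by (simp add: field_simps)
  then have "ln Z' \<le> s * ln Z"
    using Z by (metis ln_mono ln_powr powr_gt_zero less_le_not_le)
  then have "ln Z' / g' \<le> ln Z / g"
    using assms by (simp add: s_def field_simps)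
  then show ?thesis unfolding soft_min_def Z_def Z'_def n_def by simp
qed

text \<open>Second-order expansion of the partition sum: since \<open>J\<close> carries weight
  \<open>P\<close>, the estimate \<open>l / P\<close> contributes \<open>l\<close> to first and
  \<open>l\<^sup>2 / P\<close> to second order. \<open>exp_bound\<close> holds for every
  \<open>x \<ge> 0\<close>, so large estimates do no harm.\<close>

lemma soft_min_step:
  fixes L :: "'a \<Rightarrow> real"
  assumes "J \<in> A" "g > 0" "l \<ge> 0"
  defines "P \<equiv> gibbs A g L J"
  shows "soft_min A g L + l - g * l\<^sup>2 / P \<le> soft_min A g (L(J := L J + l / P))"
proof -
  define n where "n = real (card A)"
  have n: "n > 0" unfolding n_def using fin ne by (simp add: card_gt_0_iff)
  define Z where "Z = (\<Sum>i\<in>A. exp (- g * L i))"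
  define Z' where "Z' = (\<Sum>i\<in>A. exp (- g * (L(J := L J + l / P)) i))"
  have Z: "Z > 0" "Z' > 0" unfolding Z_def Z'_def using partition_pos by auto
  have P: "P > 0" using gibbs_pos by (simp add: P_def)
  have exp_bound: "exp (- x) \<le> 1 - x + x\<^sup>2" if "x \<ge> 0" for x :: real
  proof -
    have "exp (- x) \<le> 1 / (1 + x)"
      using that exp_ge_add_one_self[of x] by (simp add: exp_minus field_simps)
    also have "1 \<le> (1 + x) * (1 - x + x\<^sup>2)"
      using that by (simp add: algebra_simps power2_eq_square)
    then have "1 / (1 + x) \<le> 1 - x + x\<^sup>2"
      using that by (simp add: field_simps)
    finally show ?thesis .
  qed
  have ZJ: "exp (- g * L J) = P * Z"
    using Z by (simp add: P_def gibbs_def Z_def)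
  have "Z' = Z - P * Z + P * Z * exp (- (g * l / P))"
  proof -
    have "Z' = (\<Sum>i\<in>A - {J}. exp (- g * L i)) + exp (- g * (L J + l / P))"
      unfolding Z'_def using fin \<open>J \<in> A\<close> by (subst sum.remove[of A J]) auto
    also have "(\<Sum>i\<in>A - {J}. exp (- g * L i)) = Z - P * Z"
      unfolding Z_def ZJ[unfolded Z_def, symmetric]
      using fin \<open>J \<in> A\<close> by (subst sum.remove[of A J]) auto
    also have "exp (- g * (L J + l / P)) = P * Z * exp (- (g * l / P))"
      unfolding ZJ[symmetric] by (simp add: algebra_simps flip: exp_add)
    finally show ?thesis .
  qed
  also have "\<dots> \<le> Z - P * Z + P * Z * (1 - g * l / P + (g * l / P)\<^sup>2)"
    using exp_bound[of "g * l / P"] assms(2,3) P Z by (intro add_left_mono mult_left_mono) auto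
  also have "\<dots> = Z * (1 + (- g * l + g\<^sup>2 * l\<^sup>2 / P))"
    using P by (simp add: field_simps power2_eq_square)
  finally have le: "Z' \<le> Z * (1 + (- g * l + g\<^sup>2 * l\<^sup>2 / P))" .
  define x where "x = - g * l + g\<^sup>2 * l\<^sup>2 / P"
  \<comment> \<open>Required before taking logarithms; inherited from \<open>Z' > 0\<close>.\<close>
  have x: "1 + x > 0" using le Z unfolding x_def[symmetric]
    by (metis less_le_trans zero_less_mult_pos)
  have "ln Z' \<le> ln (Z * (1 + x))" using le Z unfolding x_def by (subst ln_le_cancel_iff) auto
  also have "\<dots> = ln Z + ln (1 + x)" using Z x by (simp add: ln_mult)
  also have "ln (1 + x) \<le> x" using ln_le_minus_one[OF x] by simp
  finally have "ln Z' / g \<le> (ln Z + x) / g" using \<open>g > 0\<close> by (simp add: divide_right_mono)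
  also have "\<dots> = ln Z / g - l + g * l\<^sup>2 / P"
    using \<open>g > 0\<close> by (simp add: x_def field_simps power2_eq_square)
  finally have "- ln Z / g + l - g * l\<^sup>2 / P \<le> - ln Z' / g" by simp
  then show ?thesis
    unfolding soft_min_def Z_def[symmetric] Z'_def[symmetric] n_def[symmetric]
    using Z n by (simp add: ln_div diff_divide_distrib)
qed

text \<open>Averaging cancels the \<open>1 / P\<close> of the second-order term, so each action
  contributes at most \<open>g * b\<^sup>2\<close>. The passage from \<open>g\<close> to
  \<open>g'\<close> is \<open>soft_min_antimono\<close>.\<close>

lemma soft_min_expected_step:
  assumes "g > 0" "g' > 0" "g' \<le> g" and l: "\<And>j. j \<in> A \<Longrightarrow> 0 \<le> l j \<and> l j \<le> b"
  shows "measure_pmf.expectation (gibbs_pmf A g L)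
           (\<lambda>j. l j - soft_min A g' (L(j := L j + l j / gibbs A g L j)))
         \<le> g * real (card A) * b\<^sup>2 - soft_min A g L"
proof -
  have "measure_pmf.expectation (gibbs_pmf A g L)
           (\<lambda>j. l j - soft_min A g' (L(j := L j + l j / gibbs A g L j)))
      = (\<Sum>j\<in>A. gibbs A g L j * (l j - soft_min A g' (L(j := L j + l j / gibbs A g L j))))"
    by (rule expectation_gibbs_pmf)
  also have "\<dots> \<le> (\<Sum>j\<in>A. g * b\<^sup>2 - gibbs A g L j * soft_min A g L)"
  proof (rule sum_mono)
    fix j assume j: "j \<in> A"
    let ?L = "L(j := L j + l j / gibbs A g L j)"
    have "soft_min A g L + l j - g * (l j)\<^sup>2 / gibbs A g L j \<le> soft_min A g' ?L"
      using soft_min_step[OF j \<open>g > 0\<close>, of "l j" L] soft_min_antimono[OF assms(2,3), of ?L] l[OF j]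
      by linarith
    then have "l j - soft_min A g' ?L \<le> g * (l j)\<^sup>2 / gibbs A g L j - soft_min A g L"
      by simp
    then have "gibbs A g L j * (l j - soft_min A g' ?L)
        \<le> gibbs A g L j * (g * (l j)\<^sup>2 / gibbs A g L j - soft_min A g L)"
      using gibbs_pos[of g L j] by (intro mult_left_mono) auto
    also have "\<dots> = g * (l j)\<^sup>2 - gibbs A g L j * soft_min A g L"
      using gibbs_pos[of g L j] by (simp add: algebra_simps)
    also have "(l j)\<^sup>2 \<le> b\<^sup>2" using l[OF j] by (intro power_mono) auto
    finally show "gibbs A g L j * (l j - soft_min A g' ?L) \<le> g * b\<^sup>2 - gibbs A g L j * soft_min A g L"
      using \<open>g > 0\<close> by simp
  qed
  also have "\<dots> = g * real (card A) * b\<^sup>2 - soft_min A g L"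
    by (simp add: sum_subtractf sum_gibbs flip: sum_distrib_right)
  finally show ?thesis .
qed

text \<open>Unbiasedness: the drawing probability cancels the importance weight.\<close>

lemma expected_estimate_step:
  assumes "j \<in> A"
  shows "measure_pmf.expectation (gibbs_pmf A g L) (\<lambda>i. (L(i := L i + l i / gibbs A g L i)) j) = L j + l j"
proof -
  have "measure_pmf.expectation (gibbs_pmf A g L) (\<lambda>i. (L(i := L i + l i / gibbs A g L i)) j)
     = (\<Sum>i\<in>A. gibbs A g L i * L j + (if i = j then l j else 0))"
    unfolding expectation_gibbs_pmf
    using gibbs_pos[of g L] by (intro sum.cong) (auto simp: algebra_simps less_imp_neq[symmetric])
  also have "\<dots> = L j + l j"
    using assms fin by (simp add: sum.distrib sum_gibbs flip: sum_distrib_right)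
  finally show ?thesis .
qed

section \<open>Distribution and expected regret of EXP3\<close>

lemma set_exp3: "js \<in> set_pmf (exp3 A g l N) \<Longrightarrow> length js = N \<and> set js \<subseteq> A"
  by (induction N arbitrary: js) (fastforce simp: set_gibbs_pmf)+

lemma finite_set_exp3: "finite (set_pmf (exp3 A g l N))"
  by (rule finite_subset[OF _ finite_lists_length_eq[OF fin, of N]]) (use set_exp3 in blast)

lemma expectation_exp3_Suc:
  fixes f :: "'a list \<Rightarrow> real"
  shows "measure_pmf.expectation (exp3 A g l (Suc N)) f =
    measure_pmf.expectation (exp3 A g l N) (\<lambda>js.
      measure_pmf.expectation (gibbs_pmf A (g N) (estimate A g l (nth js) N)) (\<lambda>j. f (js @ [j])))"
proof -
  have "measure_pmf.expectation (exp3 A g l (Suc N)) f =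
    (\<Sum>js\<in>set_pmf (exp3 A g l N). pmf (exp3 A g l N) js *
      measure_pmf.expectation (map_pmf (\<lambda>j. js @ [j]) (gibbs_pmf A (g N) (estimate A g l (nth js) N))) f)"
    unfolding exp3.simps
    by (subst pmf_expectation_bind[OF finite_set_exp3 _ subset_refl]) (auto simp: set_gibbs_pmf fin)
  also have "\<dots> = measure_pmf.expectation (exp3 A g l N) (\<lambda>js.
      measure_pmf.expectation (gibbs_pmf A (g N) (estimate A g l (nth js) N)) (\<lambda>j. f (js @ [j])))"
    by (subst integral_measure_pmf_real[OF finite_set_exp3[of g l N]]) (auto simp: mult.commute)
  finally show ?thesis .
qed

lemma exp3_expected_estimate:
  assumes "j \<in> A"
  shows "measure_pmf.expectation (exp3 A g l N) (\<lambda>js. estimate A g l (nth js) N j) = (\<Sum>i<N. l i j)"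
proof (induction N)
  case (Suc N)
  have "measure_pmf.expectation (exp3 A g l (Suc N)) (\<lambda>js. estimate A g l (nth js) (Suc N) j)
      = measure_pmf.expectation (exp3 A g l N) (\<lambda>js. estimate A g l (nth js) N j + l N j)"
    unfolding expectation_exp3_Suc
  proof (intro integral_cong_AE AE_pmfI)
    fix js assume "js \<in> set_pmf (exp3 A g l N)"
    then have "length js = N" using set_exp3 by blast
    then show "measure_pmf.expectation (gibbs_pmf A (g N) (estimate A g l ((!) js) N))
          (\<lambda>ja. estimate A g l ((!) (js @ [ja])) (Suc N) j) = estimate A g l ((!) js) N j + l N j"
      using expected_estimate_step[OF assms, of "g N" "estimate A g l ((!) js) N" "l N"]
      by (simp only: estimate_snoc Let_def)
  qed auto
  also have "\<dots> = (\<Sum>i<N. l i j) + l N j"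
    by (subst Bochner_Integration.integral_add)
       (auto simp: Suc.IH integrable_measure_pmf_finite[OF finite_set_exp3])
  finally show ?case by simp
qed simp

text \<open>\<open>soft_min_expected_step\<close> telescopes, starting from potential 0. After
  \<open>N\<close> rounds the potential is taken at the rate \<open>g N\<close> of the following
  round, hence a change of rate in each step.\<close>

lemma exp3_potential:
  assumes g: "\<And>i. g i > 0" "\<And>i. g (Suc i) \<le> g i"
    and l: "\<And>i j. i < N \<Longrightarrow> j \<in> A \<Longrightarrow> 0 \<le> l i j \<and> l i j \<le> b i"
  shows "measure_pmf.expectation (exp3 A g l N)
      (\<lambda>js. (\<Sum>i<N. l i (js ! i)) - soft_min A (g N) (estimate A g l (nth js) N))
    \<le> (\<Sum>i<N. g i * real (card A) * (b i)\<^sup>2)"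
  using l
proof (induction N)
  case 0
  then show ?case using fin ne by (simp add: soft_min_def)
next
  case (Suc N)
  let ?c = "g N * real (card A) * (b N)\<^sup>2"
  let ?E = "measure_pmf.expectation (exp3 A g l N)"
  let ?X = "\<lambda>js. (\<Sum>i<N. l i (js ! i)) - soft_min A (g N) (estimate A g l (nth js) N)"
  have int: "integrable (measure_pmf (exp3 A g l N)) f" for f :: "'a list \<Rightarrow> real"
    by (rule integrable_measure_pmf_finite[OF finite_set_exp3])
  have "measure_pmf.expectation (exp3 A g l (Suc N))
      (\<lambda>js. (\<Sum>i<Suc N. l i (js ! i)) - soft_min A (g (Suc N)) (estimate A g l (nth js) (Suc N)))
    \<le> ?E (\<lambda>js. ?X js + ?c)"
    unfolding expectation_exp3_Suc
  proof (intro integral_mono_AE int AE_pmfI)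
    fix js assume "js \<in> set_pmf (exp3 A g l N)"
    then have len: "length js = N" using set_exp3 by blast
    let ?L = "estimate A g l (nth js) N"
    have "measure_pmf.expectation (gibbs_pmf A (g N) ?L) (\<lambda>j. (\<Sum>i<Suc N. l i ((js @ [j]) ! i))
            - soft_min A (g (Suc N)) (estimate A g l (nth (js @ [j])) (Suc N)))
       = measure_pmf.expectation (gibbs_pmf A (g N) ?L) (\<lambda>j. (\<Sum>i<N. l i (js ! i)) +
           (l N j - soft_min A (g (Suc N)) (?L(j := ?L j + l N j / gibbs A (g N) ?L j))))"
      unfolding estimate_snoc[OF len] Let_def using len by (simp add: nth_append algebra_simps)
    also have "\<dots> = (\<Sum>i<N. l i (js ! i)) + measure_pmf.expectation (gibbs_pmf A (g N) ?L) (\<lambda>j.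
           (l N j - soft_min A (g (Suc N)) (?L(j := ?L j + l N j / gibbs A (g N) ?L j))))"
      by (subst Bochner_Integration.integral_add)
         (auto intro!: integrable_measure_pmf_finite simp: set_gibbs_pmf fin)
    also have "\<dots> \<le> (\<Sum>i<N. l i (js ! i)) + (?c - soft_min A (g N) ?L)"
      by (intro add_left_mono soft_min_expected_step g Suc.prems) auto
    finally show "measure_pmf.expectation (gibbs_pmf A (g N) ?L) (\<lambda>j. (\<Sum>i<Suc N. l i ((js @ [j]) ! i))
            - soft_min A (g (Suc N)) (estimate A g l (nth (js @ [j])) (Suc N))) \<le> ?X js + ?c" by simp
  qed
  also have "\<dots> = ?E ?X + ?c"
    by (subst Bochner_Integration.integral_add) (auto simp: int)
  also have "\<dots> \<le> (\<Sum>i<Suc N. g i * real (card A) * (b i)\<^sup>2)"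
    using Suc by (simp add: less_Suc_eq)
  finally show ?case .
qed

text \<open>\<open>soft_min\<close> is at most the estimate of \<open>j\<close> plus the entropy
  term \<open>ln (card A) / g N\<close>, and this estimate is unbiased.\<close>

lemma exp3_regret:
  assumes g: "\<And>i. g i > 0" "\<And>i. g (Suc i) \<le> g i"
    and l: "\<And>i j. i < N \<Longrightarrow> j \<in> A \<Longrightarrow> 0 \<le> l i j \<and> l i j \<le> b i"
    and "j \<in> A"
  shows "measure_pmf.expectation (exp3 A g l N) (\<lambda>js. \<Sum>i<N. l i (js ! i))
    \<le> (\<Sum>i<N. l i j) + ln (real (card A)) / g N + (\<Sum>i<N. g i * real (card A) * (b i)\<^sup>2)"
proof -
  let ?E = "measure_pmf.expectation (exp3 A g l N)"
  let ?L = "\<lambda>js. estimate A g l (nth js) N"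
  have int: "integrable (measure_pmf (exp3 A g l N)) f" for f :: "'a list \<Rightarrow> real"
    by (rule integrable_measure_pmf_finite[OF finite_set_exp3])
  have "?E (\<lambda>js. \<Sum>i<N. l i (js ! i)) \<le>
      ?E (\<lambda>js. ((\<Sum>i<N. l i (js ! i)) - soft_min A (g N) (?L js)) + (?L js j + ln (real (card A)) / g N))"
  proof (intro integral_mono int)
    fix js
    show "(\<Sum>i<N. l i (js ! i)) \<le>
        (\<Sum>i<N. l i (js ! i)) - soft_min A (g N) (?L js) + (?L js j + ln (real (card A)) / g N)"
      using soft_min_le[OF \<open>j \<in> A\<close> g(1), of N "?L js"] by linarith
  qed
  also have "\<dots> = ?E (\<lambda>js. (\<Sum>i<N. l i (js ! i)) - soft_min A (g N) (?L js))
      + (?E (\<lambda>js. ?L js j) + ln (real (card A)) / g N)"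
    by (simp only: Bochner_Integration.integral_add int measure_pmf.prob_space lebesgue_integral_const) simp
  finally show ?thesis
    using exp3_potential[of g N l b, OF g l] exp3_expected_estimate[OF \<open>j \<in> A\<close>, of g l N] by linarith
qed

end

section \<open>Following beliefs within a block\<close>

text \<open>
  Decidable from the requests up to round \<open>E\<close>, and it implies that \<open>q\<close> is not the next arrival of \<open>\<rho> t\<close>.
\<close>

definition observed_error :: "(nat \<Rightarrow> nat) \<Rightarrow> nat \<Rightarrow> nat \<Rightarrow> nat \<Rightarrow> bool" where
  "observed_error \<rho> E t q \<longleftrightarrow>
     (\<exists>s\<in>{t<..E}. (s < q \<and> \<rho> s = \<rho> t) \<or> (s = q \<and> \<rho> s \<noteq> \<rho> t))"

definition evict_choice :: "nat set \<Rightarrow> (nat \<Rightarrow> nat) \<Rightarrow> nat \<Rightarrow> nat" where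
  "evict_choice C b t =
     (SOME x. x \<in> C \<and> (b x \<le> t \<or> (\<forall>y\<in>C. t < b y \<and> b y \<le> b x)))"

lemma evict_choice:
  fixes b :: "nat \<Rightarrow> nat" and t :: nat
  assumes "finite C" "C \<noteq> {}"
  defines "x \<equiv> evict_choice C b t"
  shows "x \<in> C" "b x \<le> t \<or> (\<forall>y\<in>C. t < b y \<and> b y \<le> b x)"
proof -
  have "\<exists>x. x \<in> C \<and> (b x \<le> t \<or> (\<forall>y\<in>C. t < b y \<and> b y \<le> b x))"
  proof (cases "\<exists>x\<in>C. b x \<le> t")
    case False
    have "Max (b ` C) \<in> b ` C" using assms(1,2) by (intro Max_in) auto
    then obtain z where z: "z \<in> C" "b z = Max (b ` C)" by (metis imageE)
    have "b y \<le> b z" if "y \<in> C" for y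
      unfolding z(2) using that assms(1) by (intro Max_ge) auto
    then show ?thesis using False z(1) by (meson not_le)
  qed auto
  from someI_ex[OF this] show "x \<in> C" "b x \<le> t \<or> (\<forall>y\<in>C. t < b y \<and> b y \<le> b x)"
    unfolding x_def evict_choice_def by auto
qed

text \<open>
  For correct beliefs, \<open>max\<^sub>\<tau> (pending \<rho> t \<tau> Q - believed_pending b \<tau> C)\<close> is a potential function that
  proves the optimality of furthest-in-the-future against a competitor with cache \<open>Q\<close>. Each cached page
  with a refutable belief pays one extra unit, which is released when the page is evicted after its
  belief has expired. Restricting \<open>\<tau>\<close> to \<open>\<tau> \<le> E\<close> makes errors that are not observed by round \<open>E\<close>
  harmless. The belief \<open>0\<close> stands for ``no prediction'' and counts as expired.
\<close>

definition pending :: "(nat \<Rightarrow> nat) \<Rightarrow> nat \<Rightarrow> nat \<Rightarrow> nat set \<Rightarrow> nat" where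
  "pending \<rho> t \<tau> Q = card {x \<in> Q. \<exists>s\<in>{t..\<tau>}. \<rho> s = x}"

definition believed_pending :: "(nat \<Rightarrow> nat) \<Rightarrow> nat \<Rightarrow> nat set \<Rightarrow> nat" where
  "believed_pending b \<tau> C = card {x \<in> C. b x \<le> \<tau>}"

definition misbelieved :: "(nat \<Rightarrow> nat) \<Rightarrow> nat \<Rightarrow> nat \<Rightarrow> (nat \<Rightarrow> nat) \<Rightarrow> nat set \<Rightarrow> nat" where
  "misbelieved \<rho> E t b C = card {x \<in> C. b x \<le> E \<and> \<not> (t \<le> b x \<and> \<rho> (b x) = x)}"

text \<open>\<open>K\<close> bounds the number of misbelieved pages plus the positive part of the
  potential. The first conjunct survives for \<open>t > E\<close>, when no \<open>\<tau>\<close> is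
  left, and then yields the bound at the end of a block.\<close>

definition credit_suffices ::
  "(nat \<Rightarrow> nat) \<Rightarrow> nat \<Rightarrow> nat \<Rightarrow> (nat \<Rightarrow> nat) \<Rightarrow> nat set \<Rightarrow> nat set \<Rightarrow> int \<Rightarrow> bool" where
  "credit_suffices \<rho> E t b C Q K \<longleftrightarrow>
     int (misbelieved \<rho> E t b C) \<le> K \<and>
     (\<forall>\<tau>\<in>{t..E}. int (misbelieved \<rho> E t b C) + int (pending \<rho> t \<tau> Q)
                    \<le> K + int (believed_pending b \<tau> C))"

text \<open>With all beliefs expired, every cached page counts as believed pending, so the potential
  is not positive; the \<open>card C\<close> units pay for the misbelieved pages. This is the price
  of forgetting at the start of a block.\<close>

lemma credit_suffices_fresh:
  assumes "finite C" "finite Q" "card Q = card C" "K \<ge> 0"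
  shows "credit_suffices \<rho> E t (\<lambda>_. 0) C Q (K + int (card C))"
proof -
  have "misbelieved \<rho> E t (\<lambda>_. 0) C \<le> card C"
    unfolding misbelieved_def by (rule card_mono) (use assms in auto)
  moreover have "pending \<rho> t \<tau> Q \<le> card C" for \<tau>
    unfolding pending_def assms(3)[symmetric] by (rule card_mono) (use assms in auto)
  moreover have "believed_pending (\<lambda>_. 0) \<tau> C = card C" for \<tau>
    by (simp add: believed_pending_def)
  ultimately show ?thesis unfolding credit_suffices_def using assms(4)
    by (smt (verit) of_nat_mono)
qed

text \<open>The last equation reads a hit as the exchange of \<open>r\<close> for itself, so that
  the same set computations cover hits and misses.\<close>

lemma cache_step_legal:
  assumes "legal_eviction C r e" "finite C"
  shows "finite (cache_step C r e)" "card (cache_step C r e) = card C" "r \<in> cache_step C r e"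
    "cache_step C r e - {r} = C - {case e of None \<Rightarrow> r | Some x \<Rightarrow> x}"
proof -
  show "finite (cache_step C r e)" using assms by (auto simp: cache_step_def split: option.splits)
  show "card (cache_step C r e) = card C" using assms card_Suc_Diff1[of C]
    by (auto simp: cache_step_def legal_eviction_def split: option.splits if_splits)
qed (use assms in \<open>auto simp: cache_step_def legal_eviction_def split: option.splits if_splits\<close>)

text \<open>A miss is paid by evicting a misbelieved page if its belief has expired, and otherwise
  by the furthest-in-the-future argument. An observed error yields two units: one covers a new
  misbelieved page, the other a return of the page earlier than believed.\<close>

lemma credit_suffices_step:
  assumes fin: "finite C" "finite Q" and card: "card Q = card C"
    and legal: "legal_eviction C (\<rho> t) e" "legal_eviction Q (\<rho> t) f"
    and choice: "\<And>x. e = Some x \<Longrightarrow> b x \<le> t \<or> (\<forall>y\<in>C. t < b y \<and> b y \<le> b x)"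
    and t: "t \<le> E" "t < q"
    and credit: "credit_suffices \<rho> E t b C Q K"
  shows "credit_suffices \<rho> E (Suc t) (b(\<rho> t := q)) (cache_step C (\<rho> t) e) (cache_step Q (\<rho> t) f)
    (K + of_bool (\<rho> t \<notin> Q) - of_bool (\<rho> t \<notin> C) + 2 * of_bool (observed_error \<rho> E t q))"
proof -
  define r where "r = \<rho> t"
  define err where "err = (of_bool (observed_error \<rho> E t q) :: int)"
  define missQ where "missQ = (of_bool (r \<notin> Q) :: int)"
  define missC where "missC = (of_bool (r \<notin> C) :: int)"
  define x where "x = (case e of None \<Rightarrow> r | Some x \<Rightarrow> x)"
  define y where "y = (case f of None \<Rightarrow> r | Some x \<Rightarrow> x)"
  define C' where "C' = cache_step C r e"
  define Q' where "Q' = cache_step Q r f"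
  have C': "finite C'" "card C' = card C" "r \<in> C'" "C' - {r} = C - {x}"
    using cache_step_legal[OF legal(1) fin(1)] unfolding C'_def r_def x_def by auto
  have Q': "finite Q'" "card Q' = card Q" "r \<in> Q'" "Q' - {r} = Q - {y}"
    using cache_step_legal[OF legal(2) fin(2)] unfolding Q'_def r_def y_def by auto
  have xC: "x \<in> C" "r \<in> C \<Longrightarrow> x = r"
    using legal(1) by (auto simp: legal_eviction_def x_def r_def split: if_splits)
  have yQ: "y \<in> Q" "r \<in> Q \<Longrightarrow> y = r"
    using legal(2) by (auto simp: legal_eviction_def y_def r_def split: if_splits)
  have x_choice: "b x \<le> t \<or> (\<forall>y\<in>C. t < b y \<and> b y \<le> b x)" if "r \<notin> C"
    using legal(1) choice that by (auto simp: legal_eviction_def x_def r_def)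
  define W where "W = {z \<in> C. b z \<le> E \<and> \<not> (t \<le> b z \<and> \<rho> (b z) = z)}"
  define K' where "K' = K + missQ - missC + 2 * err"
  have finW: "finite W" unfolding W_def using fin by simp
  have K: "int (card W) \<le> K"
    "\<And>\<tau>. \<tau> \<in> {t..E} \<Longrightarrow> int (card W) + int (pending \<rho> t \<tau> Q) \<le> K + int (believed_pending b \<tau> C)"
    using credit unfolding credit_suffices_def misbelieved_def W_def by auto
  let ?b = "b(r := q)"
  have W': "int (misbelieved \<rho> E (Suc t) ?b C') \<le> int (card (W - {x})) + err"
  proof -
    have "{z \<in> C'. ?b z \<le> E \<and> \<not> (Suc t \<le> ?b z \<and> \<rho> (?b z) = z)}
        \<subseteq> (W - {x}) \<union> (if observed_error \<rho> E t q then {r} else {})" (is "?l \<subseteq> ?r")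
    proof
      fix z assume z: "z \<in> ?l"
      show "z \<in> ?r"
      proof (cases "z = r")
        case True
        then have "observed_error \<rho> E t q"
          using z t unfolding observed_error_def r_def by (intro bexI[of _ q]) auto
        then show ?thesis using True by simp
      next
        case False
        then have "z \<in> C - {x}" using z C'(4) by auto
        \<comment> \<open>If \<open>b z = t\<close>, the belief was already wrong before this round,
          because \<open>\<rho> t = r\<close> differs from \<open>z\<close>.\<close>
        moreover have "\<not> (t \<le> b z \<and> \<rho> (b z) = z)"
          using z False by (cases "b z = t") (auto simp: r_def)
        ultimately show ?thesis using z False unfolding W_def by auto
      qed
    qed
    then have "misbelieved \<rho> E (Suc t) ?b C' \<le> card ?r"
      unfolding misbelieved_def by (rule card_mono[rotated]) (use finW in auto)
    also have "\<dots> \<le> card (W - {x}) + card (if observed_error \<rho> E t q then {r} else {})"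
      by (rule card_Un_le)
    finally show ?thesis unfolding err_def by (auto split: if_splits)
  qed
  have err: "0 \<le> err" by (simp add: err_def)
  \<comment> \<open>The extra \<open>err\<close> on the left keeps one of the two units in reserve;
    the case \<open>b x \<le> \<tau>\<close> below spends it.\<close>
  have credit1: "int (misbelieved \<rho> E (Suc t) ?b C') + err + missC \<le> K + missQ + 2 * err"
  proof (cases "r \<in> C \<or> r \<notin> Q")
    case True
    then have "missC \<le> missQ" by (auto simp: missC_def missQ_def)
    moreover have "card (W - {x}) \<le> card W" by (intro card_mono finW) auto
    ultimately show ?thesis using W' K(1) by linarith
  next
    case False
    then have m: "missC = 1" "missQ = 0" by (auto simp: missC_def missQ_def)
    show ?thesis
    proof (cases "b x \<le> t")
      case True
      then have "x \<in> W" using xC False t unfolding W_def r_def by auto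
      then have "card (W - {x}) + 1 = card W" using finW card_Suc_Diff1[of W x] by simp
      then show ?thesis using W' K(1) m by linarith
    next
      case bx: False
      then have "\<forall>y\<in>C. t < b y" using x_choice False by auto
      \<comment> \<open>The potential at \<open>\<tau> = t\<close>: nothing is believed to be due,
        but the competitor holds the requested page, so \<open>K\<close> exceeds
        \<open>card W\<close> by at least one.\<close>
      then have "believed_pending b t C = 0" by (auto simp: believed_pending_def card_eq_0_iff)
      moreover have "{r} \<subseteq> {z \<in> Q. \<exists>s\<in>{t..t}. \<rho> s = z}" using False by (auto simp: r_def)
      then have "pending \<rho> t t Q \<ge> 1" unfolding pending_def
        using card_mono[of "{z \<in> Q. \<exists>s\<in>{t..t}. \<rho> s = z}" "{r}"] fin by simp
      moreover have "card (W - {x}) \<le> card W" by (intro card_mono finW) auto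
      ultimately show ?thesis using W' K(2)[of t] t m by simp
    qed
  qed
  have credit2: "int (misbelieved \<rho> E (Suc t) ?b C') + int (pending \<rho> (Suc t) \<tau> Q')
      \<le> K' + int (believed_pending ?b \<tau> C')" if \<tau>: "\<tau> \<in> {Suc t..E}" for \<tau>
  proof -
    define again where "again = (\<exists>s\<in>{Suc t..\<tau>}. \<rho> s = r)"
    define F where "F = {z \<in> Q. \<exists>s\<in>{t..\<tau>}. \<rho> s = z}"
    define G where "G = {z \<in> C. b z \<le> \<tau>}"
    have finFG: "finite F" "finite G" using fin by (auto simp: F_def G_def)
    \<comment> \<open>A return of \<open>r\<close> by time \<open>\<tau>\<close> is either predicted
      or shows that \<open>q\<close> is too late.\<close>
    have again: "of_bool again \<le> of_bool (q \<le> \<tau>) + err"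
    proof (cases "again \<and> \<not> q \<le> \<tau>")
      case True
      then obtain s where "s \<in> {Suc t..\<tau>}" "\<rho> s = r" by (auto simp: again_def)
      then have "observed_error \<rho> E t q"
        using True \<tau> unfolding observed_error_def r_def by (intro bexI[of _ s]) auto
      then show ?thesis by (simp add: err_def)
    qed (auto simp: err_def)
    have "{z \<in> Q'. \<exists>s\<in>{Suc t..\<tau>}. \<rho> s = z} \<subseteq> (F - {y}) \<union> (if again then {r} else {})"
    proof
      fix z assume z: "z \<in> {z \<in> Q'. \<exists>s\<in>{Suc t..\<tau>}. \<rho> s = z}"
      then have "z \<noteq> r \<Longrightarrow> z \<in> Q - {y}" using Q'(4) by auto
      then show "z \<in> (F - {y}) \<union> (if again then {r} else {})"
        using z unfolding F_def again_def by (cases "z = r") (auto intro!: bexI simp: Suc_leD)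
    qed
    then have "pending \<rho> (Suc t) \<tau> Q' \<le> card ((F - {y}) \<union> (if again then {r} else {}))"
      unfolding pending_def by (rule card_mono[rotated]) (use finFG in auto)
    also have "\<dots> \<le> card (F - {y}) + card (if again then {r} else {})" by (rule card_Un_le)
    finally have F': "int (pending \<rho> (Suc t) \<tau> Q') \<le> int (card (F - {y})) + of_bool again"
      by (auto split: if_splits)
    have "{z \<in> C'. ?b z \<le> \<tau>} = (G - {x}) - {r} \<union> (if q \<le> \<tau> then {r} else {})"
      using C'(3,4) unfolding G_def by auto
    moreover have "(G - {x}) - {r} = G - {x}"
      using xC unfolding G_def by auto
    moreover have "r \<notin> G - {x}" using xC unfolding G_def by auto
    ultimately have G': "int (believed_pending ?b \<tau> C') = int (card (G - {x})) + of_bool (q \<le> \<tau>)"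
      unfolding believed_pending_def using finFG by auto
    have FG': "int (pending \<rho> (Suc t) \<tau> Q') + int (card (G - {x}))
        \<le> int (believed_pending ?b \<tau> C') + int (card (F - {y})) + err"
      using F' G' again by linarith
    \<comment> \<open>If the competitor hits, \<open>y = r\<close> is pending through the present
      request and leaves \<open>F\<close>; if it misses, \<open>missQ\<close> makes up for the
      unit.\<close>
    have F1: "int (card (F - {y})) + 1 \<le> int (card F) + missQ"
    proof (cases "r \<in> Q")
      case True
      then have "y \<in> F" using yQ \<tau> by (auto simp: F_def r_def)
      then have "card (F - {y}) + 1 = card F" using finFG card_Suc_Diff1[of F y] by simp
      then show ?thesis by (simp add: missQ_def)
    next
      case False
      have "card (F - {y}) \<le> card F" by (intro card_mono finFG) auto
      then show ?thesis using False by (simp add: missQ_def)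
    qed
    have G1: "int (card G) \<le> int (card (G - {x})) + of_bool (x \<in> G)"
      using finFG(2) card_Suc_Diff1[of G x] by auto
    have KF: "int (card W) + int (card F) \<le> K + int (card G)"
      using K(2)[of \<tau>] \<tau> unfolding pending_def believed_pending_def F_def G_def by simp
    have W1: "int (card (W - {x})) + of_bool (x \<in> W) = int (card W)"
      using finW card_Suc_Diff1[of W x] by auto
    have ob: "of_bool (x \<in> G) \<le> (1 :: int)" "of_bool (x \<in> W) \<ge> (0 :: int)" by auto
    show ?thesis
    proof (cases "r \<in> C")
      case True
      then have "missC = 0" by (simp add: missC_def)
      then show ?thesis using FG' F1 G1 KF W1 W' ob unfolding K'_def by linarith
    next
      case miss: False
      then have missC: "missC = 1" by (simp add: missC_def)
      show ?thesis
      proof (cases "b x \<le> t")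
        case True
        then have "x \<in> W" using xC miss t unfolding W_def r_def by auto
        then have "of_bool (x \<in> W) = (1 :: int)" by simp
        then show ?thesis using FG' F1 G1 KF W1 W' ob missC unfolding K'_def by linarith
      next
        case False
        then have all: "\<forall>y\<in>C. b y \<le> b x" using x_choice miss by auto
        show ?thesis
        \<comment> \<open>\<open>x\<close> has the latest belief. If it is due by
          \<open>\<tau>\<close>, so is all of \<open>C\<close>, and the equally large cache of the
          competitor cannot have more pending pages; otherwise evicting \<open>x\<close> leaves
          \<open>G\<close> unchanged.\<close>
        proof (cases "b x \<le> \<tau>")
          case True
          then have "G = C" using all unfolding G_def by (auto intro: order_trans)
          then have "card (G - {x}) + 1 = card C" using xC fin card_Suc_Diff1[of C x] by simp
          moreover have "card (F - {y}) \<le> card (Q - {y})"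
            using fin by (intro card_mono) (auto simp: F_def)
          moreover have "card (Q - {y}) + 1 = card Q" using yQ fin card_Suc_Diff1[of Q y] by simp
          ultimately have "int (card (F - {y})) \<le> int (card (G - {x}))" using card by linarith
          then show ?thesis using FG' credit1 unfolding K'_def by linarith
        next
          case False
          then have "of_bool (x \<in> G) = (0 :: int)" by (simp add: G_def)
          then show ?thesis using FG' F1 G1 KF W1 W' ob missC unfolding K'_def by linarith
        qed
      qed
    qed
  qed
  have "credit_suffices \<rho> E (Suc t) ?b C' Q' K'"
    unfolding credit_suffices_def using credit1 credit2 err unfolding K'_def by auto
  then show ?thesis
    unfolding K'_def C'_def Q'_def missC_def missQ_def err_def r_def .
qed

section \<open>The block strategy\<close>

lemma cache_after_append: "cache_after C (xs @ ys) = cache_after (cache_after C xs) ys"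
  by (induction C xs rule: cache_after.induct) auto

lemma legal_run_append:
  "legal_run C (xs @ ys) \<longleftrightarrow> legal_run C xs \<and> legal_run (cache_after C xs) ys"
  by (induction C xs rule: legal_run.induct) auto

lemma num_misses_append:
  "num_misses C (xs @ ys) = num_misses C xs + num_misses (cache_after C xs) ys"
  by (induction C xs rule: num_misses.induct) auto

lemma num_misses_le_length: "num_misses C xs \<le> length xs"
  by (induction C xs rule: num_misses.induct) auto

lemma legal_run_card:
  assumes "legal_run C xs" "finite C"
  shows "finite (cache_after C xs) \<and> card (cache_after C xs) = card C"
  using assms by (induction C xs rule: legal_run.induct) (auto simp: cache_step_legal)

lemma play_append: "play S p h (xs @ ys) = bind_pmf (play S p h xs) (\<lambda>h'. play S p h' ys)"
  by (induction xs arbitrary: h)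
     (auto simp: bind_return_pmf bind_assoc_pmf case_prod_unfold)

lemma play_snoc:
  "play S p h (xs @ [r]) = bind_pmf (play S p h xs)
     (\<lambda>h'. map_pmf (\<lambda>(e, j). h' @ [Round r e j (p j (Suc (length h')))]) (S h' r))"
  by (simp add: play_append map_pmf_def case_prod_unfold)

lemma finite_set_play:
  assumes "\<And>h r. finite (set_pmf (S h r))"
  shows "finite (set_pmf (play S p h rs))"
  by (induction rs arbitrary: h) (auto simp: assms)

lemma play_support:
  assumes "h \<in> set_pmf (play S p [] rs)"
  shows "map request h = rs"
    and "t < length h \<Longrightarrow> (evicted (h ! t), queried (h ! t)) \<in> set_pmf (S (take t h) (request (h ! t)))"
    and "t < length h \<Longrightarrow> prediction (h ! t) = p (queried (h ! t)) (Suc t)"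
proof -
  have "map request h = rs \<and> (\<forall>t<length h.
      (evicted (h ! t), queried (h ! t)) \<in> set_pmf (S (take t h) (request (h ! t))) \<and>
      prediction (h ! t) = p (queried (h ! t)) (Suc t))"
    using assms
  proof (induction rs arbitrary: h rule: rev_induct)
    case (snoc r rs)
    then obtain h' e j where h': "h' \<in> set_pmf (play S p [] rs)" "(e, j) \<in> set_pmf (S h' r)"
      "h = h' @ [Round r e j (p j (Suc (length h')))]"
      by (auto simp: play_snoc)
    show ?case using snoc.IH[OF h'(1)] h'(2,3) by (auto simp: nth_append less_Suc_eq)
  qed simp
  then show "map request h = rs"
    "t < length h \<Longrightarrow> (evicted (h ! t), queried (h ! t)) \<in> set_pmf (S (take t h) (request (h ! t)))"
    "t < length h \<Longrightarrow> prediction (h ! t) = p (queried (h ! t)) (Suc t)" by auto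
qed

lemma play_legal:
  assumes "legal_strategy n M C0 S" "set rs \<subseteq> {1..n}" "h \<in> set_pmf (play S p [] rs)"
  shows "legal_run C0 (run_of h) \<and> queried ` set h \<subseteq> {1..M}"
  using assms(2,3)
proof (induction rs arbitrary: h rule: rev_induct)
  case Nil
  then show ?case by (simp add: run_of_def)
next
  case (snoc r rs)
  then obtain h' e j where h': "h' \<in> set_pmf (play S p [] rs)" "(e, j) \<in> set_pmf (S h' r)"
    "h = h' @ [Round r e j (p j (Suc (length h')))]"
    by (auto simp: play_snoc)
  have "request ` set h' = set rs" using play_support(1)[OF h'(1)] by (metis set_map)
  then have "legal_eviction (cache_after C0 (run_of h')) r e \<and> j \<in> {1..M}"
    using assms(1) snoc.IH[of h'] snoc.prems(1) h' unfolding legal_strategy_def by fastforce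
  then show ?case using snoc.IH[of h'] snoc.prems(1) h'
    by (auto simp: run_of_def legal_run_append)
qed

text \<open>
  Block \<open>i\<close> consists of the rounds \<open>S i + 1, \<dots>, S (i + 1)\<close>, so a log of length \<open>m\<close> is followed by a round
  of block \<open>block_index S m\<close>.
\<close>

definition block_index :: "(nat \<Rightarrow> nat) \<Rightarrow> nat \<Rightarrow> nat" where
  "block_index S m = (THE i. S i \<le> m \<and> m < S (Suc i))"

text \<open>At \<open>m = S i\<close> block \<open>i\<close> is about to start and is not yet
  counted.\<close>

definition blocks_started :: "(nat \<Rightarrow> nat) \<Rightarrow> nat \<Rightarrow> nat" where
  "blocks_started S m = (LEAST i. m \<le> S i)"

definition belief :: "round_log list \<Rightarrow> nat \<Rightarrow> nat" where
  "belief h = fold (\<lambda>x b. b(request x := prediction x)) h (\<lambda>_. 0)"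

definition eviction :: "(nat \<Rightarrow> nat) \<Rightarrow> nat set \<Rightarrow> round_log list \<Rightarrow> nat \<Rightarrow> nat option" where
  "eviction S C0 h r =
     (let C = cache_after C0 (run_of h) in
      if r \<in> C then None
      else Some (evict_choice C (belief (drop (S (block_index S (length h))) h)) (Suc (length h))))"

text \<open>The cut-off at \<open>length \<sigma>\<close> serves an unfinished last block; for fixed
  \<open>q\<close>, a finished block has the same loss on every prefix that contains it.\<close>

definition block_loss :: "(nat \<Rightarrow> nat) \<Rightarrow> nat list \<Rightarrow> (nat \<Rightarrow> nat) \<Rightarrow> nat \<Rightarrow> nat" where
  "block_loss S \<sigma> q i =
     (let E = min (S (Suc i)) (length \<sigma>) in
      card {t \<in> {S i<..E}. observed_error (request_at \<sigma>) E t (q t)})"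

text \<open>The loss passed to \<open>estimate\<close> ignores its action argument: the log reveals
  only the loss of the predictor queried in that block, and no other is read. Round \<open>t\<close>
  sits at index \<open>t - 1\<close> of the log, so \<open>h ! S i\<close> is the first round of
  block \<open>i\<close>.\<close>

definition block_strategy :: "(nat \<Rightarrow> nat) \<Rightarrow> (nat \<Rightarrow> real) \<Rightarrow> nat \<Rightarrow> nat set \<Rightarrow> strategy" where
  "block_strategy S g M C0 h r =
     (let i = block_index S (length h) in
      map_pmf (Pair (eviction S C0 h r))
        (if length h = S i
         then gibbs_pmf {1..M} (g i)
                (estimate {1..M} g
                  (\<lambda>i _. real (block_loss S (map request h) (\<lambda>t. prediction (h ! (t - 1))) i))
                  (\<lambda>i. queried (h ! S i)) i)
         else return_pmf (queried (h ! S i))))"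

lemma request_at_take:
  assumes "0 < s" "s \<le> m" "m \<le> length \<sigma>"
  shows "request_at (take m \<sigma>) s = request_at \<sigma> s"
  using assms by (simp add: request_at_def)

lemma observed_error_cong:
  assumes "\<And>s. t \<le> s \<Longrightarrow> s \<le> E \<Longrightarrow> \<rho> s = \<rho>' s" "t \<le> E"
  shows "observed_error \<rho> E t q = observed_error \<rho>' E t q"
  using assms unfolding observed_error_def by auto

text \<open>The next arrival is the least later round with the same request: no such round precedes
  it, and its own request is not a different one.\<close>

lemma observed_error_imp_error:
  assumes "observed_error (request_at \<sigma>) E t q" "request_at \<sigma> t > 0" "t \<le> length \<sigma>"
  shows "q \<noteq> next_arrival \<sigma> t (request_at \<sigma> t)"
proof -
  let ?P = "\<lambda>s. t < s \<and> request_at \<sigma> s = request_at \<sigma> t"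
  \<comment> \<open>A virtual request witnesses that an arrival exists; positivity of the page puts
    it after the real rounds.\<close>
  have "?P (length \<sigma> + request_at \<sigma> t)"
    using assms(2,3) by (auto simp: request_at_def[of \<sigma> "length \<sigma> + request_at \<sigma> t"])
  then have "?P (next_arrival \<sigma> t (request_at \<sigma> t))"
    unfolding next_arrival_def by (rule LeastI)
  moreover have "next_arrival \<sigma> t (request_at \<sigma> t) \<le> s" if "?P s" for s
    unfolding next_arrival_def using that by (rule Least_le)
  ultimately show ?thesis using assms(1) unfolding observed_error_def
    by (metis greaterThanAtMost_iff not_le)
qed

lemma finite_set_block_strategy: "1 \<le> M \<Longrightarrow> finite (set_pmf (block_strategy S g M C0 h r))"
  by (auto simp: block_strategy_def Let_def set_gibbs_pmf)

context
  fixes S :: "nat \<Rightarrow> nat"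
  assumes S0: "S 0 = 0" and S_mono: "strict_mono S"
begin

section \<open>Block boundaries\<close>

lemma block_index_eq:
  assumes "S i \<le> m" "m < S (Suc i)"
  shows "block_index S m = i"
  unfolding block_index_def
proof (rule the_equality)
  fix j assume "S j \<le> m \<and> m < S (Suc j)"
  then have "S j < S (Suc i)" "S i < S (Suc j)" using assms by linarith+
  then show "j = i" using S_mono by (simp add: strict_mono_less)
qed (use assms in auto)

lemma block_exists: "\<exists>i. S i \<le> m \<and> m < S (Suc i)"
proof (induction m)
  case 0
  then show ?case using S0 strict_monoD[OF S_mono, of 0 "Suc 0"] by (intro exI[of _ 0]) auto
next
  case (Suc m)
  then obtain i where i: "S i \<le> m" "m < S (Suc i)" by auto
  show ?case
  proof (cases "Suc m < S (Suc i)")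
    case False
    then show ?thesis using i strict_monoD[OF S_mono, of "Suc i" "Suc (Suc i)"]
      by (intro exI[of _ "Suc i"]) auto
  qed (use i in \<open>auto intro!: exI[of _ i]\<close>)
qed

lemma block_index: "S (block_index S m) \<le> m" "m < S (Suc (block_index S m))"
  using block_exists[of m] block_index_eq by metis+

lemma blocks_started_le: "m \<le> S (blocks_started S m)"
  unfolding blocks_started_def by (rule LeastI_ex) (use block_index(2) less_imp_le in blast)

lemma less_blocks_started: "i < blocks_started S m \<Longrightarrow> S i < m"
  unfolding blocks_started_def using not_less_Least not_le by blast

lemma blocks_started_eq:
  assumes "m \<le> S N" "\<And>i. i < N \<Longrightarrow> S i < m"
  shows "blocks_started S m = N"
  unfolding blocks_started_def using assms
  by (intro Least_equality) (auto simp: not_less[symmetric])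

lemma blocks_started_Suc:
  "blocks_started S (Suc m) =
     (if m = S (blocks_started S m) then Suc (blocks_started S m) else blocks_started S m)"
proof (rule blocks_started_eq)
  let ?N = "blocks_started S m"
  show "Suc m \<le> S (if m = S ?N then Suc ?N else ?N)"
    using blocks_started_le[of m] strict_monoD[OF S_mono, of ?N "Suc ?N"] by auto
  show "S i < Suc m" if "i < (if m = S ?N then Suc ?N else ?N)" for i
    using that less_blocks_started[of i m] by (auto simp: less_Suc_eq split: if_splits)
qed

section \<open>Legality, misses and losses along a single run\<close>

lemma block_strategy_legal:
  assumes "finite C0" "C0 \<noteq> {}" "1 \<le> M"
  shows "legal_strategy n M C0 (block_strategy S g M C0)"
  unfolding legal_strategy_def
proof (intro allI impI ballI, clarsimp)
  fix h r e j
  assume h: "request ` set h \<subseteq> {Suc 0..n}" "queried ` set h \<subseteq> {Suc 0..M}" "legal_run C0 (run_of h)"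
    and ej: "(e, j) \<in> set_pmf (block_strategy S g M C0 h r)"
  let ?C = "cache_after C0 (run_of h)"
  have C: "finite ?C" "?C \<noteq> {}" using legal_run_card[OF h(3)] assms by auto
  have "e = eviction S C0 h r" using ej by (auto simp: block_strategy_def Let_def)
  then have "legal_eviction ?C r e"
    using evict_choice(1)[OF C] by (auto simp: legal_eviction_def eviction_def Let_def)
  moreover have "j \<in> {1..M}"
  proof (cases "length h = S (block_index S (length h))")
    case True
    then show ?thesis using ej assms by (auto simp: block_strategy_def Let_def set_gibbs_pmf)
  next
    case False
    then have "h ! S (block_index S (length h)) \<in> set h"
      using block_index(1)[of "length h"] by (intro nth_mem) auto
    then show ?thesis using False ej h(2) by (auto simp: block_strategy_def Let_def)
  qed
  ultimately show "legal_eviction ?C r e \<and> Suc 0 \<le> j \<and> j \<le> M" by auto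
qed

text \<open>Pathwise comparison with an arbitrary competitor \<open>xs\<close>: each block
  contributes its fresh credit \<open>card C0\<close> and two units per observed error.\<close>

lemma block_misses:
  fixes h :: "round_log list"
  defines "\<sigma> \<equiv> map request h"
  assumes C0: "finite C0" "C0 \<noteq> {}" and legal: "legal_run C0 (run_of h)"
    and evict: "\<And>t. t < length h \<Longrightarrow> evicted (h ! t) = eviction S C0 (take t h) (request (h ! t))"
    and pred: "\<And>t. t < length h \<Longrightarrow> Suc t < prediction (h ! t)"
    and xs: "map fst xs = \<sigma>" "legal_run C0 xs"
    and N: "length h \<le> S N"
  shows "num_misses C0 (run_of h) \<le> num_misses C0 xs + card C0 * N
    + 2 * (\<Sum>i<N. block_loss S \<sigma> (\<lambda>t. prediction (h ! (t - 1))) i)"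
proof -
  define T where "T = length h"
  define \<rho> where "\<rho> = request_at \<sigma>"
  define E where "E i = min (S (Suc i)) T" for i
  define C where "C m = cache_after C0 (run_of (take m h))" for m
  define Q where "Q m = cache_after C0 (take m xs)" for m
  define mC where "mC m = int (num_misses C0 (run_of (take m h)))" for m
  define mQ where "mQ m = int (num_misses C0 (take m xs))" for m
  define lo where "lo i m = int (card {t \<in> {S i<..m}. observed_error \<rho> (E i) t (prediction (h ! (t - 1)))})" for i m
  define pre where "pre i = (\<Sum>i'<i. lo i' (E i'))" for i
  have len: "length \<sigma> = T" "length xs = T"
    using xs(1) by (auto simp: \<sigma>_def T_def dest: arg_cong[of _ _ length])
  have \<rho>: "\<rho> (Suc m) = request (h ! m)" if "m < T" for m
    using that len by (simp add: \<rho>_def request_at_def \<sigma>_def T_def)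
  have \<rho>_xs: "\<rho> (Suc m) = fst (xs ! m)" if "m < T" for m
    using that len by (simp add: \<rho>_def request_at_def xs(1)[symmetric])
  have run_h: "run_of (take (Suc m) h) = run_of (take m h) @ [(\<rho> (Suc m), evicted (h ! m))]" if "m < T" for m
    using that \<rho> by (simp add: run_of_def take_Suc_conv_app_nth T_def)
  have run_xs: "take (Suc m) xs = take m xs @ [(\<rho> (Suc m), snd (xs ! m))]" if "m < T" for m
    using that \<rho>_xs len by (simp add: take_Suc_conv_app_nth)
  have legal_h: "legal_run C0 (run_of (take m h))" for m
    using legal legal_run_append[of C0 "run_of (take m h)" "run_of (drop m h)"]
    by (simp add: run_of_def flip: map_append)
  have legal_xs: "legal_run C0 (take m xs)" for m
    using xs(2) legal_run_append[of C0 "take m xs" "drop m xs"] by simp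
  have CQ: "finite (C m)" "card (C m) = card C0" "finite (Q m)" "card (Q m) = card C0" for m
    using legal_run_card[OF legal_h C0(1)] legal_run_card[OF legal_xs C0(1)] by (auto simp: C_def Q_def)
  have Cne: "C m \<noteq> {}" for m using CQ(2)[of m] C0 by auto
  \<comment> \<open>\<open>Suc i\<close> charges the fresh credit of the current block in advance;
    \<open>pre\<close> holds the losses of the earlier blocks, and \<open>lo\<close> that of the
    current one up to round \<open>m\<close>, judged in hindsight at its end.\<close>
  define Inv where "Inv i m = credit_suffices \<rho> (E i) (Suc m) (belief (drop (S i) (take m h))) (C m) (Q m)
      (mQ m + int (card C0 * Suc i) + 2 * (pre i + lo i m) - mC m)" for i m
  have step: "Inv i (Suc m)" if "Inv i m" "S i \<le> m" "m < E i" for i m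
  proof -
    have m: "m < T" "m < S (Suc i)" using that by (auto simp: E_def)
    let ?b = "belief (drop (S i) (take m h))"
    let ?e = "evicted (h ! m)" let ?f = "snd (xs ! m)" let ?r = "\<rho> (Suc m)" let ?q = "prediction (h ! m)"
    have e: "?e = (if ?r \<in> C m then None else Some (evict_choice (C m) ?b (Suc m)))"
      using evict[of m] m \<rho>[OF m(1)] block_index_eq[OF that(2) m(2)]
      by (simp add: eviction_def Let_def T_def C_def)
    have C': "C (Suc m) = cache_step (C m) ?r ?e" "Q (Suc m) = cache_step (Q m) ?r ?f"
      unfolding C_def Q_def run_h[OF m(1)] run_xs[OF m(1)] by (simp_all add: cache_after_append)
    have miss: "mC (Suc m) = mC m + of_bool (?r \<notin> C m)" "mQ (Suc m) = mQ m + of_bool (?r \<notin> Q m)"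
      unfolding mC_def mQ_def C_def Q_def run_h[OF m(1)] run_xs[OF m(1)]
      by (simp_all add: num_misses_append)
    have legal': "legal_eviction (C m) ?r ?e" "legal_eviction (Q m) ?r ?f"
      using legal_h[of "Suc m"] legal_xs[of "Suc m"]
      unfolding C_def Q_def run_h[OF m(1)] run_xs[OF m(1)] by (simp_all add: legal_run_append)
    have b': "belief (drop (S i) (take (Suc m) h)) = ?b(?r := ?q)"
      using m that(2) \<rho>[OF m(1)] by (simp add: belief_def take_Suc_conv_app_nth T_def)
    have lo': "lo i (Suc m) = lo i m + of_bool (observed_error \<rho> (E i) (Suc m) ?q)"
    proof -
      have "{t \<in> {S i<..Suc m}. observed_error \<rho> (E i) t (prediction (h ! (t - 1)))}
        = {t \<in> {S i<..m}. observed_error \<rho> (E i) t (prediction (h ! (t - 1)))}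
          \<union> (if observed_error \<rho> (E i) (Suc m) ?q then {Suc m} else {})"
        using that(2) by (auto simp: le_Suc_eq)
      then show ?thesis by (auto simp: lo_def)
    qed
    have "credit_suffices \<rho> (E i) (Suc (Suc m)) (?b(?r := ?q)) (cache_step (C m) ?r ?e) (cache_step (Q m) ?r ?f)
      (mQ m + int (card C0 * Suc i) + 2 * (pre i + lo i m) - mC m
        + of_bool (?r \<notin> Q m) - of_bool (?r \<notin> C m) + 2 * of_bool (observed_error \<rho> (E i) (Suc m) ?q))"
    proof (rule credit_suffices_step)
      show "?b x \<le> Suc m \<or> (\<forall>y\<in>C m. Suc m < ?b y \<and> ?b y \<le> ?b x)" if "?e = Some x" for x
        using that evict_choice(2)[OF CQ(1) Cne, where b = ?b and t = "Suc m"] unfolding e by (auto split: if_splits)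
      show "Suc m < ?q" using pred m by (simp add: T_def)
    qed (use CQ legal' that in \<open>auto simp: Inv_def\<close>)
    then show ?thesis unfolding Inv_def C' b' miss lo' by (simp add: algebra_simps)
  qed
  have block: "mC (E i) \<le> mQ (E i) + int (card C0 * Suc i) + 2 * pre (Suc i)"
    if IH: "mC (S i) \<le> mQ (S i) + int (card C0 * i) + 2 * pre i" and "S i \<le> T" for i
  proof -
    have Si: "S i \<le> E i" using that strict_monoD[OF S_mono, of i "Suc i"] by (simp add: E_def)
    have start: "Inv i (S i)"
      using credit_suffices_fresh[of "C (S i)" "Q (S i)" "mQ (S i) + int (card C0 * i) + 2 * pre i - mC (S i)" \<rho> "E i" "Suc (S i)"]
        IH CQ by (simp add: Inv_def belief_def lo_def algebra_simps)
    have "Inv i (E i)"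
      by (rule dec_induct[OF Si, of "Inv i", OF start]) (rule step)
    \<comment> \<open>The round counter has passed \<open>E i\<close>, so the first conjunct of
      \<open>credit_suffices\<close> decides: its left side is nonnegative.\<close>
    then show ?thesis unfolding Inv_def credit_suffices_def pre_def by simp
  qed
  have "mC (min (S i) T) \<le> mQ (min (S i) T) + int (card C0 * i) + 2 * pre i" for i
  proof (induction i)
    case 0
    then show ?case by (simp add: S0 mC_def mQ_def pre_def run_of_def)
  next
    case (Suc i)
    show ?case
    proof (cases "S i \<le> T")
      case True
      then show ?thesis using block[of i] Suc by (simp add: E_def)
    next
      \<comment> \<open>Blocks that start after the last round contain no requests.\<close>
      case False
      then have "min (S i) T = T" "min (S (Suc i)) T = T"
        using strict_monoD[OF S_mono, of i "Suc i"] by auto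
      moreover have "pre i \<le> pre (Suc i)" by (simp add: pre_def lo_def)
      ultimately show ?thesis using Suc by (simp add: algebra_simps)
    qed
  qed
  from this[of N] have "int (num_misses C0 (run_of h)) \<le> int (num_misses C0 xs) + int (card C0 * N) + 2 * pre N"
    using N len by (simp add: T_def[symmetric] min_absorb2 mC_def mQ_def)
  moreover have "pre N = int (\<Sum>i<N. block_loss S \<sigma> (\<lambda>t. prediction (h ! (t - 1))) i)"
    unfolding pre_def lo_def block_loss_def Let_def len E_def[symmetric] \<rho>_def by simp
  ultimately show ?thesis by linarith
qed

text \<open>Blocks are disjoint, and observed errors are true errors by
  \<open>observed_error_imp_error\<close>.\<close>

lemma sum_block_loss_le:
  assumes "set \<sigma> \<subseteq> {1..n}"
  shows "(\<Sum>i<N. block_loss S \<sigma> q i) \<le> num_errors \<sigma> q"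
proof -
  let ?T = "length \<sigma>"
  let ?P = "\<lambda>t. q t \<noteq> next_arrival \<sigma> t (request_at \<sigma> t)"
  have "(\<Sum>i<N. block_loss S \<sigma> q i) \<le> card {t \<in> {0<..min (S N) ?T}. ?P t}"
  proof (induction N)
    case (Suc N)
    let ?E = "min (S (Suc N)) ?T"
    let ?B = "{t \<in> {S N<..?E}. ?P t}"
    have "block_loss S \<sigma> q N \<le> card ?B"
      unfolding block_loss_def Let_def
    proof (rule card_mono, simp, safe)
      fix t assume t: "t \<in> {S N<..?E}" and obs: "observed_error (request_at \<sigma>) ?E t (q t)"
      have "request_at \<sigma> t \<in> set \<sigma>" using t by (auto simp: request_at_def)
      then have "request_at \<sigma> t > 0" using assms by auto
      then show False if "q t = next_arrival \<sigma> t (request_at \<sigma> t)"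
        using observed_error_imp_error[OF obs] t that by auto
    qed
    then have "(\<Sum>i<Suc N. block_loss S \<sigma> q i) \<le> card {t \<in> {0<..min (S N) ?T}. ?P t} + card ?B"
      using Suc.IH by simp
    also have "\<dots> = card ({t \<in> {0<..min (S N) ?T}. ?P t} \<union> ?B)"
      by (subst card_Un_disjoint) auto
    also have "\<dots> \<le> card {t \<in> {0<..?E}. ?P t}"
      using strict_monoD[OF S_mono, of N "Suc N"] by (intro card_mono) auto
    finally show ?case .
  qed simp
  also have "\<dots> \<le> num_errors \<sigma> q"
    unfolding num_errors_def by (intro card_mono) auto
  finally show ?thesis .
qed

section \<open>Coupling with EXP3 and expected cost\<close>

context
  fixes g :: "nat \<Rightarrow> real" and M :: nat and C0 :: "nat set" and p :: "nat \<Rightarrow> nat \<Rightarrow> nat" and \<sigma> :: "nat list"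
  assumes M: "1 \<le> M"
begin

lemma block_strategy_support:
  assumes h: "h \<in> set_pmf (play (block_strategy S g M C0) p [] rs)" and t: "t < length h"
  shows "evicted (h ! t) = eviction S C0 (take t h) (request (h ! t))"
    and "S i \<le> t \<Longrightarrow> t < S (Suc i) \<Longrightarrow> queried (h ! t) = queried (h ! S i)"
proof -
  have *: "(evicted (h ! t), queried (h ! t)) \<in> set_pmf (block_strategy S g M C0 (take t h) (request (h ! t)))"
    using play_support(2)[OF h t] .
  then show "evicted (h ! t) = eviction S C0 (take t h) (request (h ! t))"
    by (auto simp: block_strategy_def Let_def)
  assume i: "S i \<le> t" "t < S (Suc i)"
  then have "block_index S t = i" by (rule block_index_eq)
  then show "queried (h ! t) = queried (h ! S i)"
    using * i t by (cases "t = S i") (auto simp: block_strategy_def Let_def)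
qed

text \<open>A block queries a single predictor, and the first \<open>m\<close> rounds contain all
  requests on which the loss of block \<open>i\<close> depends; so the log determines the true loss
  of that predictor.\<close>

lemma block_loss_support:
  assumes h: "h \<in> set_pmf (play (block_strategy S g M C0) p [] (take m \<sigma>))"
    and m: "m \<le> length \<sigma>" "min (S (Suc i)) (length \<sigma>) \<le> m"
  shows "block_loss S (take m \<sigma>) (\<lambda>t. prediction (h ! (t - 1))) i = block_loss S \<sigma> (p (queried (h ! S i))) i"
proof -
  define E where "E = min (S (Suc i)) (length \<sigma>)"
  have E: "E \<le> m" "min (S (Suc i)) (length (take m \<sigma>)) = E" using m by (auto simp: E_def)
  have len: "length h = m" using play_support(1)[OF h] m by (metis length_map length_take min_absorb2)
  have "observed_error (request_at (take m \<sigma>)) E t (prediction (h ! (t - 1))) \<longleftrightarrow>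
      observed_error (request_at \<sigma>) E t (p (queried (h ! S i)) t)" if "t \<in> {S i<..E}" for t
  proof -
    have t: "t - 1 < length h" "S i \<le> t - 1" "t - 1 < S (Suc i)" "Suc (t - 1) = t"
      using that E len by (auto simp: E_def)
    have "prediction (h ! (t - 1)) = p (queried (h ! S i)) t"
      using play_support(3)[OF h t(1)] block_strategy_support(2)[OF h t(1,2,3)] t(4) by simp
    then show ?thesis
      using that E m by (auto intro!: observed_error_cong request_at_take)
  qed
  then show ?thesis
    unfolding block_loss_def Let_def E E_def[symmetric] by (intro arg_cong[where f = card]) auto
qed

text \<open>Since \<open>\<sigma>\<close> and \<open>p\<close> are fixed, evictions do not affect
  the draws. Each round either opens a block and appends one draw, or leaves the list of drawn
  predictors unchanged.\<close>

lemma exp3_coupling: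
  assumes "m \<le> length \<sigma>"
  shows "map_pmf (\<lambda>h. map (\<lambda>i. queried (h ! S i)) [0..<blocks_started S m])
      (play (block_strategy S g M C0) p [] (take m \<sigma>))
    = exp3 {1..M} g (\<lambda>i j. real (block_loss S \<sigma> (p j) i)) (blocks_started S m)"
  using assms
proof (induction m)
  case 0
  have "blocks_started S 0 = 0" by (rule blocks_started_eq) auto
  then show ?case by simp
next
  case (Suc m)
  define N where "N = blocks_started S m"
  define r where "r = \<sigma> ! m"
  let ?str = "block_strategy S g M C0"
  let ?l = "\<lambda>i j. real (block_loss S \<sigma> (p j) i)"
  let ?js = "\<lambda>N h. map (\<lambda>i. queried (h ! S i)) [0..<N]"
  let ?log = "\<lambda>h (e, j). h @ [Round r e j (p j (Suc (length h)))]"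
  have take: "take (Suc m) \<sigma> = take m \<sigma> @ [r]"
    using Suc.prems by (simp add: take_Suc_conv_app_nth r_def)
  have IH: "map_pmf (?js N) (play ?str p [] (take m \<sigma>)) = exp3 {1..M} g ?l N"
    using Suc by (simp add: N_def)
  have len: "length h = m" if "h \<in> set_pmf (play ?str p [] (take m \<sigma>))" for h
    using play_support(1)[OF that] Suc.prems by (metis Suc_leD length_map length_take min_absorb2)
  have before: "S i < m" if "i < N" for i
    using that less_blocks_started by (simp add: N_def)
  have unfold: "map_pmf (?js N') (play ?str p [] (take (Suc m) \<sigma>)) =
      bind_pmf (play ?str p [] (take m \<sigma>)) (\<lambda>h. map_pmf (\<lambda>x. ?js N' (?log h x)) (?str h r))" for N'
    unfolding take play_snoc map_bind_pmf by (simp add: pmf.map_comp o_def case_prod_unfold)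
  have js_snoc: "?js N (h @ [x]) = ?js N h" if "length h = m" for h x
    using before that by (auto simp: nth_append)
  show ?case
  proof (cases "m = S N")
    case True
    have idx: "block_index S m = N"
      using strict_monoD[OF S_mono, of N "Suc N"] True by (intro block_index_eq) auto
    have "map_pmf (?js (Suc N)) (play ?str p [] (take (Suc m) \<sigma>)) =
      bind_pmf (play ?str p [] (take m \<sigma>)) (\<lambda>h. map_pmf (\<lambda>j. ?js N h @ [j])
        (gibbs_pmf {1..M} (g N) (estimate {1..M} g ?l (nth (?js N h)) N)))"
      unfolding unfold
    proof (rule bind_pmf_cong[OF refl])
      fix h assume h: "h \<in> set_pmf (play ?str p [] (take m \<sigma>))"
      have "estimate {1..M} g (\<lambda>i _. real (block_loss S (map request h) (\<lambda>t. prediction (h ! (t - 1))) i))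
          (\<lambda>i. queried (h ! S i)) N = estimate {1..M} g ?l (nth (?js N h)) N"
      proof (rule estimate_cong)
        fix i assume i: "i < N"
        then have "S (Suc i) \<le> m" using True S_mono by (simp add: strict_mono_less_eq)
        then show "real (block_loss S (map request h) (\<lambda>t. prediction (h ! (t - 1))) i)
            = real (block_loss S \<sigma> (p (queried (h ! S i))) i)"
          using block_loss_support[OF h, of i] Suc.prems play_support(1)[OF h] by simp
      qed auto
      then have "?str h r = map_pmf (Pair (eviction S C0 h r))
          (gibbs_pmf {1..M} (g N) (estimate {1..M} g ?l (nth (?js N h)) N))"
        using True idx len[OF h] by (simp add: block_strategy_def Let_def)
      moreover have "?js (Suc N) (h @ [x]) = ?js N h @ [queried x]" for x
        using js_snoc[OF len[OF h], of x] len[OF h] True by (simp add: nth_append)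
      ultimately show "map_pmf (\<lambda>x. ?js (Suc N) (?log h x)) (?str h r) = map_pmf (\<lambda>j. ?js N h @ [j])
        (gibbs_pmf {1..M} (g N) (estimate {1..M} g ?l (nth (?js N h)) N))"
        by (simp add: pmf.map_comp o_def del: upt_Suc)
    qed
    also have "\<dots> = exp3 {1..M} g ?l (Suc N)"
      unfolding exp3.simps IH[symmetric] bind_map_pmf ..
    finally show ?thesis
      using blocks_started_Suc[of m] True unfolding N_def[symmetric] by (simp only: if_True refl)
  next
    case False
    \<comment> \<open>The round continues a block, so the predictor is copied from the log and
      nothing is drawn.\<close>
    have nb: "m \<noteq> S (block_index S m)"
    proof
      assume eq: "m = S (block_index S m)"
      have "blocks_started S m = block_index S m"
      proof (rule blocks_started_eq)
        show "m \<le> S (block_index S m)" using eq by (rule eq_refl)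
        show "S i < m" if "i < block_index S m" for i
          using strict_monoD[OF S_mono that] eq[symmetric] by simp
      qed
      then show False using eq False by (metis N_def)
    qed
    have "map_pmf (?js N) (play ?str p [] (take (Suc m) \<sigma>)) =
        bind_pmf (play ?str p [] (take m \<sigma>)) (\<lambda>h. return_pmf (?js N h))"
      unfolding unfold
    proof (rule bind_pmf_cong[OF refl])
      fix h assume h: "h \<in> set_pmf (play ?str p [] (take m \<sigma>))"
      show "map_pmf (\<lambda>x. ?js N (?log h x)) (?str h r) = return_pmf (?js N h)"
        unfolding block_strategy_def Let_def using nb len[OF h]
        by (simp add: js_snoc[OF len[OF h]])
    qed
    also have "\<dots> = exp3 {1..M} g ?l N" using IH by (simp add: map_pmf_def)
    finally show ?thesis
      using blocks_started_Suc[of m] False unfolding N_def[symmetric] by (simp only: if_False)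
  qed
qed

text \<open>\<open>block_misses\<close> against an optimal run holds for every outcome; in
  expectation, the coupling turns the block losses into EXP3 losses bounded by the block
  lengths.\<close>

lemma block_strategy_cost:
  assumes params: "paging_params n k C0" and \<sigma>: "set \<sigma> \<subseteq> {1..n}" and nat: "NAT_predictors n M \<sigma> p"
    and j: "j \<in> {1..M}" and g: "\<And>i. g i > 0" "\<And>i. g (Suc i) \<le> g i"
  defines "N \<equiv> blocks_started S (length \<sigma>)"
  shows "expected_cost (block_strategy S g M C0) C0 p \<sigma> \<le> real (OPT C0 \<sigma>) + real k * real N
    + 2 * (real (num_errors \<sigma> (p j)) + ln (real M) / g N
           + (\<Sum>i<N. g i * real M * (real (S (Suc i) - S i))\<^sup>2))"
proof -
  let ?str = "block_strategy S g M C0"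
  let ?play = "play ?str p [] \<sigma>"
  let ?l = "\<lambda>i j. real (block_loss S \<sigma> (p j) i)"
  let ?js = "\<lambda>h. map (\<lambda>i. queried (h ! S i)) [0..<N]"
  have C0: "finite C0" "C0 \<noteq> {}" "card C0 = k"
    using params by (auto simp: paging_params_def intro: finite_subset)
  have legal: "legal_strategy n M C0 ?str" by (rule block_strategy_legal[OF C0(1,2) M])
  have finite_play: "finite (set_pmf ?play)" by (intro finite_set_play finite_set_block_strategy M)
  have int: "integrable (measure_pmf ?play) f" for f :: "round_log list \<Rightarrow> real"
    by (rule integrable_measure_pmf_finite[OF finite_play])
  \<comment> \<open>A run of the strategy itself shows that legal runs exist, so the infimum in
    \<open>OPT\<close> is attained.\<close>
  obtain h0 where "h0 \<in> set_pmf ?play" using set_pmf_not_empty by fast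
  then have "map fst (run_of h0) = \<sigma> \<and> legal_run C0 (run_of h0)"
    using play_legal[OF legal \<sigma>] play_support(1) by (auto simp: run_of_def o_def)
  then have "{num_misses C0 xs |xs. map fst xs = \<sigma> \<and> legal_run C0 xs} \<noteq> {}" by blast
  from Inf_nat_def1[OF this] obtain xs where xs: "map fst xs = \<sigma>" "legal_run C0 xs" "OPT C0 \<sigma> = num_misses C0 xs"
    unfolding OPT_def by blast
  have path: "real (num_misses C0 (run_of h)) \<le> real (OPT C0 \<sigma>) + real k * real N + 2 * (\<Sum>i<N. ?l i (?js h ! i))"
    if h: "h \<in> set_pmf ?play" for h
  proof -
    have req: "map request h = \<sigma>" by (rule play_support(1)[OF h])
    then have len: "length h = length \<sigma>" by (metis length_map)
    have hm: "h \<in> set_pmf (play ?str p [] (take (length \<sigma>) \<sigma>))" using h by simp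
    have "num_misses C0 (run_of h) \<le> num_misses C0 xs + card C0 * N
      + 2 * (\<Sum>i<N. block_loss S (map request h) (\<lambda>t. prediction (h ! (t - 1))) i)"
    proof (rule block_misses[OF C0(1,2)])
      show "legal_run C0 (run_of h)" using play_legal[OF legal \<sigma> h] by simp
      show "Suc t < prediction (h ! t)" if "t < length h" for t
      proof -
        have "queried (h ! t) \<in> {1..M}"
          using play_legal[OF legal \<sigma> h] that by (meson image_subset_iff nth_mem)
        then show ?thesis
          using nat that len play_support(3)[OF h that] unfolding NAT_predictors_def by fastforce
      qed
    qed (use block_strategy_support(1)[OF h] xs req len blocks_started_le in \<open>auto simp: N_def\<close>)
    also have "(\<Sum>i<N. block_loss S (map request h) (\<lambda>t. prediction (h ! (t - 1))) i)
        = (\<Sum>i<N. block_loss S \<sigma> (p (?js h ! i)) i)"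
      using block_loss_support[OF hm] req by (intro sum.cong) auto
    finally have "real (num_misses C0 (run_of h)) \<le> real (num_misses C0 xs + card C0 * N
        + 2 * (\<Sum>i<N. block_loss S \<sigma> (p (?js h ! i)) i))" by (rule of_nat_mono)
    then show ?thesis using xs(3) C0(3) by simp
  qed
  have loss_bound: "0 \<le> ?l i j \<and> ?l i j \<le> real (S (Suc i) - S i)" for i j
  proof -
    have "block_loss S \<sigma> (p j) i \<le> card {S i<..S (Suc i)}"
      unfolding block_loss_def Let_def by (intro card_mono) auto
    then show ?thesis by simp
  qed
  have "expected_cost ?str C0 p \<sigma> \<le>
      measure_pmf.expectation ?play (\<lambda>h. (real (OPT C0 \<sigma>) + real k * real N) + 2 * (\<Sum>i<N. ?l i (?js h ! i)))"
    unfolding expected_cost_def by (intro integral_mono_AE int AE_pmfI path)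
  also have "\<dots> = real (OPT C0 \<sigma>) + real k * real N
      + 2 * measure_pmf.expectation ?play (\<lambda>h. \<Sum>i<N. ?l i (?js h ! i))"
    by (subst Bochner_Integration.integral_add) (auto simp: int)
  also have "measure_pmf.expectation ?play (\<lambda>h. \<Sum>i<N. ?l i (?js h ! i))
      = measure_pmf.expectation (map_pmf ?js ?play) (\<lambda>js. \<Sum>i<N. ?l i (js ! i))"
    by (rule integral_map_pmf[symmetric])
  also have "map_pmf ?js ?play = exp3 {1..M} g ?l N"
    using exp3_coupling[of "length \<sigma>"] by (simp add: N_def)
  also have "measure_pmf.expectation (exp3 {1..M} g ?l N) (\<lambda>js. \<Sum>i<N. ?l i (js ! i))
      \<le> (\<Sum>i<N. ?l i j) + ln (real (card {1..M})) / g N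
        + (\<Sum>i<N. g i * real (card {1..M}) * (real (S (Suc i) - S i))\<^sup>2)"
    by (rule exp3_regret) (use M g loss_bound j in auto)
  also have "(\<Sum>i<N. ?l i j) \<le> real (num_errors \<sigma> (p j))"
    using sum_block_loss_le[OF \<sigma>, where N = N and q = "p j"] by (simp flip: of_nat_sum)
  finally show ?thesis by simp
qed

end

end

section \<open>Block lengths and learning rates\<close>

text \<open>With its square root as block length, \<open>n\<close> blocks cover at least order
  \<open>n powr (3/2) / M powr (3/4)\<close> rounds, so that \<open>T\<close> rounds start at most
  order \<open>T powr (2/3) * M powr (1/2)\<close> blocks, up to one. The schedule does not depend
  on \<open>T\<close>.\<close>

definition horizon_scale :: "nat \<Rightarrow> nat \<Rightarrow> real" where
  "horizon_scale M i = 1 + real (Suc i) / (real M * sqrt (real M))"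

definition block_length :: "nat \<Rightarrow> nat \<Rightarrow> nat" where
  "block_length M i = nat \<lceil>sqrt (horizon_scale M i)\<rceil>"

definition block_start :: "nat \<Rightarrow> nat \<Rightarrow> nat" where
  "block_start M i = (\<Sum>i'<i. block_length M i')"

text \<open>Balances \<open>M\<close> times the squared block length, so that each block adds at
  most a constant to the variance term of the regret.\<close>

definition learning_rate :: "nat \<Rightarrow> nat \<Rightarrow> real" where
  "learning_rate M i = 1 / (real M * horizon_scale M i)"

lemma horizon_scale_ge_1: "horizon_scale M i \<ge> 1"
  by (simp add: horizon_scale_def)

lemma block_length_bounds:
  "sqrt (horizon_scale M i) \<le> real (block_length M i)"
  "real (block_length M i) \<le> 2 * sqrt (horizon_scale M i)"
proof -
  have "sqrt (horizon_scale M i) \<ge> 1" using horizon_scale_ge_1 by simp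
  then show "sqrt (horizon_scale M i) \<le> real (block_length M i)"
    "real (block_length M i) \<le> 2 * sqrt (horizon_scale M i)"
    unfolding block_length_def by linarith+
qed

lemma block_start_0: "block_start M 0 = 0"
  by (simp add: block_start_def)

lemma block_start_Suc: "block_start M (Suc i) - block_start M i = block_length M i"
  by (simp add: block_start_def)

lemma strict_mono_block_start: "strict_mono (block_start M)"
proof (rule strict_monoI_Suc)
  fix i
  have "real (block_length M i) \<ge> 1"
    using block_length_bounds(1)[of M i] horizon_scale_ge_1[of M i] by (meson order_trans real_sqrt_ge_1_iff)
  then show "block_start M i < block_start M (Suc i)" by (simp add: block_start_def)
qed

lemma learning_rate_pos: "M \<ge> 1 \<Longrightarrow> learning_rate M i > 0"
  using horizon_scale_ge_1[of M i] by (simp add: learning_rate_def)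

lemma learning_rate_antimono: "M \<ge> 1 \<Longrightarrow> learning_rate M (Suc i) \<le> learning_rate M i"
  unfolding learning_rate_def using horizon_scale_ge_1[of M i] horizon_scale_ge_1[of M "Suc i"]
  by (intro divide_left_mono mult_left_mono mult_pos_pos)
     (linarith | simp add: horizon_scale_def divide_right_mono)+

lemma learning_rate_block_length:
  assumes "M \<ge> 1"
  shows "learning_rate M i * real M * (real (block_length M i))\<^sup>2 \<le> 4"
proof -
  let ?u = "horizon_scale M i"
  have "(real (block_length M i))\<^sup>2 \<le> (2 * sqrt ?u)\<^sup>2"
    using block_length_bounds(2) by (intro power_mono) auto
  also have "\<dots> = 4 * ?u" using horizon_scale_ge_1[of M i] by simp
  finally show ?thesis using assms horizon_scale_ge_1[of M i]
    by (simp add: learning_rate_def field_simps)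
qed

text \<open>Discrete form of integrating the square root: the increment of
  \<open>n powr (3/2)\<close> is at most \<open>3/2 * sqrt (n + 1)\<close>.\<close>

lemma sum_sqrt_ge: "real n * sqrt (real n) \<le> 3 / 2 * (\<Sum>i<n. sqrt (real (Suc i)))"
proof (induction n)
  case (Suc n)
  define x where "x = sqrt (real n)"
  define y where "y = sqrt (real (Suc n))"
  have xy: "0 \<le> x" "x \<le> y" "real n = x\<^sup>2" "real (Suc n) = y\<^sup>2" by (auto simp: x_def y_def)
  have "y\<^sup>2 * y - x\<^sup>2 * x = (y - x) * (y\<^sup>2 + x * y + x\<^sup>2)"
    by (simp add: algebra_simps power2_eq_square)
  also have "\<dots> \<le> (y - x) * (3 / 2 * y * (y + x))"
  proof (intro mult_left_mono)
    have "x\<^sup>2 \<le> y\<^sup>2" "x\<^sup>2 \<le> x * y" using xy by (auto simp: power2_eq_square intro: mult_mono mult_left_mono)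
    then show "y\<^sup>2 + x * y + x\<^sup>2 \<le> 3 / 2 * y * (y + x)" by (simp add: algebra_simps power2_eq_square)
  qed (use xy in auto)
  also have "\<dots> = 3 / 2 * y * (y\<^sup>2 - x\<^sup>2)" by (simp add: algebra_simps power2_eq_square)
  also have "y\<^sup>2 - x\<^sup>2 = 1" using xy(3,4) by simp
  finally show ?case using Suc xy by (simp add: x_def[symmetric] y_def[symmetric])
qed simp

text \<open>Lets \<open>M * ln M\<close> be absorbed into \<open>M powr (3/2)\<close>.\<close>

lemma ln_le_two_sqrt:
  assumes "x > 0"
  shows "ln x \<le> 2 * sqrt (x :: real)"
proof -
  have "ln x = 2 * ln (sqrt x)" using assms by (simp add: ln_sqrt)
  also have "\<dots> \<le> 2 * (sqrt x - 1)" using ln_le_minus_one[of "sqrt x"] assms by simp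
  finally show ?thesis by simp
qed

lemma mult_sqrt_powr: "x \<ge> 0 \<Longrightarrow> x * sqrt x = x powr (3/2)"
  using powr_add[of x 1 "1/2"] by (cases "x = 0") (auto simp: powr_half_sqrt)

text \<open>All started blocks but the last are complete, so their total length is below
  \<open>T\<close>. Solving the lower bound of order \<open>n powr (3/2)\<close> for
  \<open>n\<close> gives the claim; the \<open>+ 1\<close> is the last block.\<close>

lemma blocks_started_block_start_le:
  assumes "M \<ge> 1" "T \<ge> 1"
  defines "R \<equiv> real T powr (2/3) * real M powr (1/2)"
  shows "real (blocks_started (block_start M) T) \<le> 3 / 2 * R + 1"
proof (cases "blocks_started (block_start M) T")
  case 0
  then show ?thesis by (simp add: R_def)
next
  case (Suc n)
  let ?X = "real M * sqrt (real M)"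
  have X: "?X > 0" using assms by simp
  have "real n * sqrt (real n) \<le> 3 / 2 * (\<Sum>i<n. sqrt (real (Suc i)))" by (rule sum_sqrt_ge)
  also have "(\<Sum>i<n. sqrt (real (Suc i))) \<le> (\<Sum>i<n. sqrt ?X * real (block_length M i))"
  proof (rule sum_mono)
    fix i
    have "sqrt (real (Suc i)) = sqrt ?X * sqrt (real (Suc i) / ?X)"
      using assms(1) unfolding real_sqrt_mult[symmetric] by simp
    also have "\<dots> \<le> sqrt ?X * sqrt (horizon_scale M i)"
      using X by (intro mult_left_mono) (auto simp: horizon_scale_def)
    also have "\<dots> \<le> sqrt ?X * real (block_length M i)"
      using X block_length_bounds(1) by (intro mult_left_mono) auto
    finally show "sqrt (real (Suc i)) \<le> sqrt ?X * real (block_length M i)" .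
  qed
  also have "\<dots> = sqrt ?X * real (block_start M n)"
    by (simp add: block_start_def sum_distrib_left)
  also have "\<dots> \<le> sqrt ?X * real T"
    using less_blocks_started[OF block_start_0 strict_mono_block_start, of n M T] Suc X
    by (intro mult_left_mono) auto
  finally have "real n powr (3/2) \<le> 3 / 2 * (sqrt ?X * real T)"
    by (simp add: mult_sqrt_powr)
  then have "(real n powr (3/2)) powr (2/3) \<le> (3 / 2 * (sqrt ?X * real T)) powr (2/3)"
    by (intro powr_mono2) auto
  also have "\<dots> = (3/2) powr (2/3) * ((sqrt ?X) powr (2/3) * real T powr (2/3))"
    by (simp only: powr_mult)
  \<comment> \<open>\<open>sqrt ?X\<close> is \<open>M powr (3/4)\<close>.\<close>
  also have "sqrt ?X powr (2/3) = real M powr (1/2)"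
    unfolding mult_sqrt_powr[OF of_nat_0_le_iff] by (simp add: powr_powr flip: powr_half_sqrt)
  also have "(3/2) powr (2/3) * (real M powr (1/2) * real T powr (2/3)) \<le> (3/2) powr 1 * R"
    unfolding R_def mult.commute[of "real M powr (1/2)"] by (intro mult_right_mono powr_mono) auto
  finally have "real n \<le> 3 / 2 * R" by (simp add: powr_powr)
  then show ?thesis using Suc by simp
qed

section \<open>The tuned algorithm and its cost\<close>

definition block_algorithm :: algorithm where
  "block_algorithm n k M C0 = block_strategy (block_start M) (learning_rate M) M C0"

lemma online_block_algorithm: "online_paging_algorithm block_algorithm"
  unfolding online_paging_algorithm_def block_algorithm_def
proof (intro allI impI)
  fix n k M :: nat and C0 :: "nat set"
  assume "paging_params n k C0 \<and> 1 \<le> M"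
  then show "legal_strategy n M C0 (block_strategy (block_start M) (learning_rate M) M C0)"
    by (intro block_strategy_legal[OF block_start_0 strict_mono_block_start])
       (auto simp: paging_params_def intro: finite_subset)
qed

lemma expected_cost_le_length:
  assumes "\<And>h r. finite (set_pmf (A h r))"
  shows "expected_cost A C0 p \<sigma> \<le> real (length \<sigma>)"
proof -
  have "expected_cost A C0 p \<sigma> \<le> measure_pmf.expectation (play A p [] \<sigma>) (\<lambda>_. real (length \<sigma>))"
    unfolding expected_cost_def
  proof (intro integral_mono_AE AE_pmfI integrable_measure_pmf_finite finite_set_play assms)
    fix h assume "h \<in> set_pmf (play A p [] \<sigma>)"
    then have "length h = length \<sigma>" using play_support(1) by (metis length_map)
    then show "real (num_misses C0 (run_of h)) \<le> real (length \<sigma>)"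
      using num_misses_le_length[of C0 "run_of h"] by (simp add: run_of_def)
  qed
  then show ?thesis by simp
qed

text \<open>The cases split at \<open>X = M powr (3/2)\<close>, the value of \<open>T\<close> at
  which \<open>R = T\<close>. Up to it, \<open>T \<le> R\<close> and the trivial bound suffices;
  beyond it, \<open>X \<le> R\<close>, and every term except the error count is of order
  \<open>k * R\<close>.\<close>

lemma block_algorithm_cost:
  assumes params: "paging_params n k C0" and \<sigma>: "set \<sigma> \<subseteq> {1..n}" and M: "1 \<le> M"
    and nat: "NAT_predictors n M \<sigma> p"
  shows "expected_cost (block_algorithm n k M C0) C0 p \<sigma> - real (OPT C0 \<sigma>)
    \<le> 41 * (real (eta_min M \<sigma> p) + real (length \<sigma>) powr (2/3) * real k * real M powr (1/2))"
proof -
  define T where "T = length \<sigma>"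
  define R where "R = real T powr (2/3) * real M powr (1/2)"
  define X where "X = real M * sqrt (real M)"
  let ?cost = "expected_cost (block_algorithm n k M C0) C0 p \<sigma>"
  have k: "k \<ge> 1" using params by (simp add: paging_params_def)
  have R0: "R \<ge> 0" by (simp add: R_def)
  have kR: "R \<le> real k * R" using k R0 mult_right_mono[of 1 "real k" R] by simp
  have X13: "X powr (1/3) = real M powr (1/2)" by (simp add: X_def mult_sqrt_powr powr_powr)
  have split: "x = x powr (2/3) * x powr (1/3)" if "x \<ge> 0" for x :: real
    using that by (cases "x = 0") (auto simp flip: powr_add)
  have "?cost - real (OPT C0 \<sigma>) \<le> 41 * (real (eta_min M \<sigma> p) + real k * R)"
  proof (cases "real T \<le> X")
    case True
    have "?cost \<le> real T"
      unfolding T_def block_algorithm_def by (intro expected_cost_le_length finite_set_block_strategy M)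
    also have "\<dots> = real T powr (2/3) * real T powr (1/3)" by (rule split) simp
    also have "\<dots> \<le> R" unfolding R_def X13[symmetric] by (intro mult_left_mono powr_mono2 True) auto
    finally show ?thesis using kR R0 by simp
  next
    case False
    have X1: "X > 0" using M by (simp add: X_def)
    then have T: "T \<ge> 1" using False by (cases T) auto
    have R1: "R \<ge> 1" unfolding R_def using T M
      by (intro mult_ge1_I ge_one_powr_ge_zero) auto
    have XR: "X \<le> R"
    proof -
      have "X = X powr (2/3) * X powr (1/3)" using X1 by (intro split) simp
      also have "\<dots> \<le> R" unfolding R_def X13 using False X1 by (intro mult_right_mono powr_mono2) auto
      finally show ?thesis .
    qed
    define N where "N = blocks_started (block_start M) T"
    \<comment> \<open>The additive 1 in the number of blocks is absorbed by
      \<open>R \<ge> 1\<close>.\<close>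
    have N: "real N \<le> 5 / 2 * R"
      using blocks_started_block_start_le[OF M T] R1 by (simp add: N_def R_def)
    have "eta_min M \<sigma> p \<in> (\<lambda>j. num_errors \<sigma> (p j)) ` {1..M}"
      unfolding eta_min_def using M by (intro Min_in) auto
    then obtain j where j: "j \<in> {1..M}" "eta_min M \<sigma> p = num_errors \<sigma> (p j)" by auto
    have cost: "?cost \<le> real (OPT C0 \<sigma>) + real k * real N + 2 * (real (num_errors \<sigma> (p j))
        + ln (real M) / learning_rate M N
        + (\<Sum>i<N. learning_rate M i * real M * (real (block_start M (Suc i) - block_start M i))\<^sup>2))"
      unfolding block_algorithm_def N_def T_def
      by (rule block_strategy_cost[OF block_start_0 strict_mono_block_start M params \<sigma> nat j(1)])
         (use learning_rate_pos learning_rate_antimono M in auto)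
    have "(\<Sum>i<N. learning_rate M i * real M * (real (block_start M (Suc i) - block_start M i))\<^sup>2) \<le> (\<Sum>i<N. 4)"
      unfolding block_start_Suc by (intro sum_mono learning_rate_block_length M)
    also have "\<dots> = 4 * real N" by simp
    finally have variance: "(\<Sum>i<N. learning_rate M i * real M * (real (block_start M (Suc i) - block_start M i))\<^sup>2) \<le> 4 * real N" .
    have "ln (real M) / learning_rate M N = ln (real M) * (real M * horizon_scale M N)"
      by (simp add: learning_rate_def)
    also have "\<dots> \<le> 2 * sqrt (real M) * (real M * horizon_scale M N)"
      using M horizon_scale_ge_1[of M N] by (intro mult_right_mono ln_le_two_sqrt) auto
    also have "\<dots> = 2 * (X * horizon_scale M N)" by (simp add: X_def)
    \<comment> \<open>Splits the entropy term into \<open>X\<close> and the number of blocks, both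
      of order \<open>R\<close>.\<close>
    also have "X * horizon_scale M N = X + real (Suc N)"
      using X1 unfolding horizon_scale_def X_def[symmetric] by (simp add: field_simps)
    finally have ln_term: "ln (real M) / learning_rate M N \<le> 2 * (X + real (Suc N))" .
    have "real k * real N \<le> real k * (5 / 2 * R)" using N by (intro mult_left_mono) auto
    then have "?cost - real (OPT C0 \<sigma>) \<le> 5 / 2 * (real k * R) + 2 * (real (eta_min M \<sigma> p) + 2 * (X + real (Suc N)) + 4 * real N)"
      using cost variance ln_term j(2) by simp
    also have "\<dots> \<le> 41 * (real (eta_min M \<sigma> p) + real k * R)"
    proof -
      \<comment> \<open>The coefficient of \<open>a\<close> is
        \<open>5/2 + 2 * (2 * (1 + 5/2 + 1) + 4 * 5/2) = 81/2\<close>, rounded up to 41.\<close>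
      have "5 / 2 * a + 2 * (e + 2 * (x + (m + 1)) + 4 * m) \<le> 41 * (e + a)"
        if "x \<le> r" "m \<le> 5 / 2 * r" "1 \<le> r" "r \<le> a" "0 \<le> e" for a e x m r :: real
        using that by argo
      from this[OF XR N R1 kR, of "real (eta_min M \<sigma> p)"] show ?thesis by (simp add: add.commute)
    qed
    finally show ?thesis .
  qed
  then show ?thesis by (simp add: R_def T_def mult_ac)
qed

theorem theorem5:
  "\<exists>(A :: algorithm) (c :: real). online_paging_algorithm A \<and> c > 0 \<and>
     (\<forall>(n :: nat) (k :: nat) (M :: nat) (C0 :: nat set) (\<sigma> :: nat list) (p :: nat \<Rightarrow> nat \<Rightarrow> nat).
        paging_params n k C0 \<and> set \<sigma> \<subseteq> {1..n} \<and> 1 \<le> M \<and> NAT_predictors n M \<sigma> p \<longrightarrow>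
        expected_cost (A n k M C0) C0 p \<sigma> - real (OPT C0 \<sigma>)
          \<le> c * (real (eta_min M \<sigma> p)
                 + real (length \<sigma>) powr (2/3) * real k * real M powr (1/2)))"
proof (rule exI[of _ block_algorithm], rule exI[of _ 41], intro conjI allI impI)
  show "online_paging_algorithm block_algorithm" by (rule online_block_algorithm)
  fix n k M :: nat and C0 :: "nat set" and \<sigma> :: "nat list" and p :: "nat \<Rightarrow> nat \<Rightarrow> nat"
  assume "paging_params n k C0 \<and> set \<sigma> \<subseteq> {1..n} \<and> 1 \<le> M \<and> NAT_predictors n M \<sigma> p"
  then show "expected_cost (block_algorithm n k M C0) C0 p \<sigma> - real (OPT C0 \<sigma>)
    \<le> 41 * (real (eta_min M \<sigma> p) + real (length \<sigma>) powr (2/3) * real k * real M powr (1/2))"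
    using block_algorithm_cost by blast
qed simp

end
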